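(* Consider the system without stochastic perturbation ($G=0$), $\dot x=h(x,u,t)+d(x,t)$, with contracting control law $u^*(x,x_d,u_d,t)$, contraction metric $M(x,t)=\Theta(x,t)^{\top}\Theta(x,t)$, learned control law $u_L(x,x_d,u_d,t)$, target trajectory $x_d$ and virtual system $q$ as described in the context. Suppose: (A1) for all $(x,x_d,u_d,t)\in S=S_x\times S_x\times S_u\times S_t$, $\|u_L(x,x_d,u_d,t)-u^*(x,x_d,u_d,t)\|\le\epsilon_{\ell0}+\epsilon_{\ell1}\int_{x_d}^{x}\|\delta q\|$, where $S_x\subset\mathbb{R}^n$, $S_u\subset\mathbb{R}^m$, $S_t\subset\mathbb{R}_+$ are given compact sets and $\epsilon_{\ell0},\epsilon_{\ell1}\ge0$; (A2) there is $L_u\in[0,\infty)$ such that $\|h(x,u,t)-h(x,u',t)\|\le L_u\|u-u'\|$ for all $u,u'\in\mathbb{R}^m$, $x\in S_x$, $t\in S_t$; and that $u^*$ and $M$ satisfy, for some $\alpha\in(0,\infty)$, $$\dot M+2\,\mathrm{sym}\left(M\frac{\partial h(x,u^*(x,x_d,u_d,t),t)}{\partial x}\right)+2\alpha M(x,t)\preceq0,\quad\forall x,t.$$ Let $x_d$ be the target trajectory and $x$ the trajectory controlled by $u=u_L$ with $G=0$. If there exist $\underline m,\overline m\in(0,\infty)$ with $\underline mI\preceq M(x,t)\preceq\overline mI$ for all $x,t$, and if $\epsilon_{\ell1}$ is small enough that $$\alpha_\ell:=\alpha-L_u\epsilon_{\ell1}\sqrt{\overline m/\underline m}>0,$$ then,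 for all $(x,t)\in S_x\times S_t$, $$\|x(t)-x_d(t)\|\le\frac{\|V_\ell(0)\|}{\sqrt{\underline m}}e^{-\alpha_\ell t}+\frac{L_u\epsilon_{\ell0}+\bar d}{\alpha_\ell}\sqrt{\frac{\overline m}{\underline m}}\left(1-e^{-\alpha_\ell t}\right),$$ where $V_\ell(t)=\int_{x_d}^{x}\|\Theta(q(t),t)\,\delta q(t)\|$.
   Context: Notation: $\|\cdot\|$ is the Euclidean norm for vectors and the induced 2-norm for matrices, $\mathrm{sym}(A)=(A+A^{\top})/2$, and $\delta x$ denotes an infinitesimal displacement at fixed time. System: $\dot x=h(x,u,t)+d(x,t)$, where $t\in\mathbb{R}_+$, $x(t)\in\mathbb{R}^n$ is the state, $u\in\mathbb{R}^m$ the control input, $h:\mathbb{R}^n\times\mathbb{R}^m\times\mathbb{R}_+\to\mathbb{R}^n$ a known smooth function, and $d:\mathbb{R}^n\times\mathbb{R}_+\to\mathbb{R}^n$ an unknown bounded function with $\sup_{x,t}\|d(x,t)\|=\bar d\in[0,\infty)$. Contraction: $M(x,t)=\Theta(x,t)^{\top}\Theta(x,t)\succ0$ (uniformly positive definite) and a feedback law $u^*(x,x_d,u_d,t)$ are called a contraction metric and a contracting control law if $\dot M+2\,\mathrm{sym}(M\,\partial h(x,u^*(x,x_d,u_d,t),t)/\partial x)+\Xi(x,t)\preceq0$ for all $x,t$, for some $\Xi(x,t)\succ0$. Here $\dot M=\partial M/\partial t+\sum_i(\partial M/\partial x_i)\,h_i(x,u^*,t)$, and $\partial h(x,u^*(x,\ldots),t)/\partial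 x$ is the total derivative in $x$, including the dependence of $u^*$ on $x$. Target trajectory: $x_d$ solves $\dot x_d=h(x_d,u_d,t)$ where $u_d=u^*(x_d,x_d,u_d,t)$. Learned control: $u_L(x,x_d,u_d,t)$ is a control law (parameterized by a deep neural network model of the contraction metric) approximating $u^*$; $x$ denotes the trajectory of the system with $u=u_L$. Virtual system: $\dot q=h(q,u^*(q,x_d,u_d,t),t)+d_q(q,t)$, having $q=x$ and $q=x_d$ as particular solutions. The function $d_q$ is parameterized linearly along the path from $x_d$ to $x$: for a smooth path $q(\mu,t)$, $\mu\in[0,1]$, with $q(0,t)=x_d(t)$ and $q(1,t)=x(t)$, $d_q=\mu\,[h(x,u_L(x,x_d,u_d,t),t)-h(x,u^*(x,x_d,u_d,t),t)+d(x,t)]$; so $d_q=0$ at $q=x_d$ and $d_q=h(x,u_L,t)-h(x,u^*,t)+d(x,t)$ at $q=x$. Path integrals: $\int_{x_d}^{x}\|\delta q\|=\int_0^1\|\partial q/\partial\mu\|\,d\mu$ and $\int_{x_d}^{x}\|\Theta\,\delta q\|=\int_0^1\|\Theta(q,t)\,\partial q/\partial\mu\|\,d\mu$.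
   Formalization: The bound at t is claimed only if (x,x_d,u_d,s) stays in S for all s in [0,t] (else u_L is unconstrained earlier and the bound can fail); in (A1) the path integral bound is required for every smooth path from x_d to x, not just the virtual path q. *)

theory Defs
  imports "HOL-Analysis.Analysis"
begin

(* k times continuously differentiable on S. The derivative is taken within S, so it is
   one-sided on the boundary of S; it is unique for the sets used here, namely the whole
   space, the unit interval, and products of whole spaces with the time axis {0..}.
   Iterating over directional derivatives keeps the type of f fixed in the recursion. *)
primrec Ck_on :: "nat \<Rightarrow> ('a::real_normed_vector \<Rightarrow> 'b::real_normed_vector) \<Rightarrow> 'a set \<Rightarrow> bool" where
  "Ck_on 0 f S \<longleftrightarrow> continuous_on S f"
| "Ck_on (Suc k) f S \<longleftrightarrow>
     (\<exists>f'. (\<forall>x\<in>S. (f has_derivative f' x) (at x within S)) \<and> (\<forall>v. Ck_on k (\<lambda>x. f' x v) S))"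

definition smooth_on :: "('a::real_normed_vector \<Rightarrow> 'b::real_normed_vector) \<Rightarrow> 'a set \<Rightarrow> bool" where
  "smooth_on f S \<longleftrightarrow> (\<forall>k. Ck_on k f S)"

definition sym_part :: "real^'n^'n \<Rightarrow> real^'n^'n" where
  "sym_part A = (1/2) *\<^sub>R (A + transpose A)"

definition pos_semidef :: "real^'n^'n \<Rightarrow> bool" where
  "pos_semidef A \<longleftrightarrow> transpose A = A \<and> (\<forall>v. 0 \<le> v \<bullet> (A *v v))"

definition loewner_le :: "real^'n^'n \<Rightarrow> real^'n^'n \<Rightarrow> bool"  (infix "\<preceq>" 50) where
  "A \<preceq> B \<longleftrightarrow> pos_semidef (B - A)"

(* dM/dt + sum_i (dM/dx_i) f_i at (x,t): the derivative of a time-varying matrix field M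
   along the velocity f. The time derivative is one-sided at t = 0. *)
definition metric_rate :: "(real^'n \<Rightarrow> real \<Rightarrow> real^'n^'n) \<Rightarrow> real^'n \<Rightarrow> real^'n \<Rightarrow> real \<Rightarrow> real^'n^'n" where
  "metric_rate M f x t =
     vector_derivative (\<lambda>s. M x s) (at t within {0..})
     + (\<Sum>i\<in>UNIV. (f $ i) *\<^sub>R frechet_derivative (\<lambda>y. M y t) (at x) (axis i 1))"

definition smooth_path :: "(real \<Rightarrow> real^'n) \<Rightarrow> real^'n \<Rightarrow> real^'n \<Rightarrow> bool" where
  "smooth_path \<gamma> a b \<longleftrightarrow> smooth_on \<gamma> {0..1} \<and> \<gamma> 0 = a \<and> \<gamma> 1 = b"

definition path_len :: "(real \<Rightarrow> real^'n) \<Rightarrow> real" where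
  "path_len \<gamma> = integral {0..1} (\<lambda>\<mu>. norm (vector_derivative \<gamma> (at \<mu> within {0..1})))"

definition weighted_path_len :: "(real^'n \<Rightarrow> real^'n^'n) \<Rightarrow> (real \<Rightarrow> real^'n) \<Rightarrow> real" where
  "weighted_path_len \<Theta> \<gamma> =
     integral {0..1} (\<lambda>\<mu>. norm (\<Theta> (\<gamma> \<mu>) *v vector_derivative \<gamma> (at \<mu> within {0..1})))"

end

theory Submission
  imports Defs
begin

text \<open>
  Let D(t) be the geodesic distance from x_d(t) to x(t) in the Riemannian metric M(.,t). Pushing a
  nearly shortest curve forward along the closed-loop field f of time t, i.e. by y + s f(y),
  shrinks its length by the factor 1 - \<alpha> s + o(s), and the endpoints then have to be moved by
  o(s) and s |g| + o(s), where g is the perturbation at x. Hence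
  D' \<le> - \<alpha> D + sqrt m_hi |g| as an upper right Dini derivative. Assumption A1 for the straight
  segment bounds |g| by L_u \<epsilon>0 + dbar + L_u \<epsilon>1 D / sqrt m_lo, a comparison argument
  integrates the inequality, and D(0) is at most the weighted length of q(.,0).

  The length of the virtual path q(.,t) itself is not differentiated: its evolution contains the
  derivative of M along d_q, which the contraction condition does not control, and q has no
  assumed joint regularity.
\<close>

section \<open>Geodesic distance of a Finsler speed\<close>

text \<open>\<open>D\<close> enters only as an infimum: no minimising geodesic has to exist, and
  \<open>D\<close> is never assumed differentiable. Curves only have to survive being pushed forward
  and then prolonged at both ends, so the admissible curves are finite chains of C1 pieces. The push
  is an Euler step with explicit derivative \<open>v + s *\<^sub>R Df y v\<close>, not the flow, so
  no existence or regularity theory for the differential equation enters. The obstacle is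
  uniformity: the first-order estimate for the speed is uniform only on compact sets, while nearly
  shortest curves could range over the whole space. The lower bound on M removes it, since a curve
  of length l stays within l / sqrt m_lo of its start. The ratio sqrt (m_hi / m_lo) has two sources:
  sqrt m_hi prices a Euclidean displacement of an endpoint, and 1 / sqrt m_lo converts D back to
  Euclidean distance. The second is used twice, when A1 is fed into the rate and in the final
  bound.\<close>

inductive joined :: "('a::euclidean_space \<Rightarrow> 'a \<Rightarrow> real) \<Rightarrow> 'a \<Rightarrow> 'a \<Rightarrow> real \<Rightarrow> bool" for N where
  C1_path: "(\<And>\<sigma>. \<sigma> \<in> {0..1} \<Longrightarrow> (\<gamma> has_vector_derivative \<gamma>' \<sigma>) (at \<sigma> within {0..1})) \<Longrightarrow>
    continuous_on {0..1} \<gamma>' \<Longrightarrow> integral {0..1} (\<lambda>\<sigma>. N (\<gamma> \<sigma>) (\<gamma>' \<sigma>)) \<le> l \<Longrightarrow>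
    joined N (\<gamma> 0) (\<gamma> 1) l"
| concat: "joined N a b l \<Longrightarrow> joined N b c k \<Longrightarrow> joined N a c (l + k)"

text \<open>In \<open>joined\<close> the number \<open>l\<close> is an upper bound for the length,
  not the length itself; the infimum is the same, and estimates of curves can be inserted
  directly.\<close>

definition geo_dist :: "('a::euclidean_space \<Rightarrow> 'a \<Rightarrow> real) \<Rightarrow> 'a \<Rightarrow> 'a \<Rightarrow> real" where
  "geo_dist N a b = Inf {l. joined N a b l}"

text \<open>The two bounds have separate tasks: \<open>lower\<close> confines a curve of given
  length to a ball, \<open>upper\<close> prices a straight segment.\<close>

locale finsler =
  fixes N :: "'a::euclidean_space \<Rightarrow> 'a \<Rightarrow> real" and lo hi :: real
  assumes continuous: "continuous_on UNIV (\<lambda>(y, v). N y v)"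
    and lo_pos: "lo > 0"
    and lower: "lo * norm v \<le> N y v"
    and upper: "N y v \<le> hi * norm v"
begin

lemma speed_integrable:
  assumes "continuous_on S \<gamma>" "continuous_on S \<gamma>'" "S = {a..b::real}"
  shows "(\<lambda>\<sigma>. N (\<gamma> \<sigma>) (\<gamma>' \<sigma>)) integrable_on S"
proof -
  have "continuous_on S (\<lambda>\<sigma>. (\<lambda>(y, v). N y v) (\<gamma> \<sigma>, \<gamma>' \<sigma>))"
    by (rule continuous_on_compose2[OF continuous]) (auto intro!: continuous_intros assms(1,2))
  then show ?thesis
    unfolding assms(3) by (auto intro: integrable_continuous_real)
qed

lemma speed_nonneg: "0 \<le> N y v"
  using lower[of v y] lo_pos by (meson dual_order.trans less_imp_le mult_nonneg_nonneg norm_ge_zero)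

text \<open>Integrating \<gamma>' up to \<tau> and bounding its norm by the speed over
  \<open>lo\<close>. An intermediate \<tau> is allowed because \<open>joined_map\<close> must keep
  the whole curve in a ball, not only its endpoint.\<close>

lemma dist_along_path_le:
  assumes der: "\<And>\<sigma>. \<sigma> \<in> {0..1} \<Longrightarrow> (\<gamma> has_vector_derivative \<gamma>' \<sigma>) (at \<sigma> within {0..1})"
    and cont: "continuous_on {0..1} \<gamma>'"
    and \<tau>: "\<tau> \<in> {0..1}"
  shows "lo * norm (\<gamma> \<tau> - \<gamma> 0) \<le> integral {0..1} (\<lambda>\<sigma>. N (\<gamma> \<sigma>) (\<gamma>' \<sigma>))"
proof -
  have c\<gamma>: "continuous_on {0..1} \<gamma>"
    using der by (meson continuous_on_eq_continuous_within has_vector_derivative_continuous)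
  have sub: "{0..\<tau>} \<subseteq> {0..1}" using \<tau> by auto
  have "(\<gamma>' has_integral (\<gamma> \<tau> - \<gamma> 0)) {0..\<tau>}"
    using \<tau> sub by (intro fundamental_theorem_of_calculus)
      (auto intro: has_vector_derivative_within_subset[OF der])
  then have eq: "\<gamma> \<tau> - \<gamma> 0 = integral {0..\<tau>} \<gamma>'" and i1: "\<gamma>' integrable_on {0..\<tau>}"
    by (auto simp: integral_unique)
  have i2: "(\<lambda>\<sigma>. N (\<gamma> \<sigma>) (\<gamma>' \<sigma>)) integrable_on {0..\<tau>}"
    using continuous_on_subset[OF c\<gamma> sub] continuous_on_subset[OF cont sub]
    by (intro speed_integrable) auto
  have i3: "(\<lambda>\<sigma>. N (\<gamma> \<sigma>) (\<gamma>' \<sigma>)) integrable_on {0..1}"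
    using c\<gamma> cont by (intro speed_integrable) auto
  have "norm (\<gamma> \<tau> - \<gamma> 0) \<le> integral {0..\<tau>} (\<lambda>\<sigma>. N (\<gamma> \<sigma>) (\<gamma>' \<sigma>) / lo)"
    unfolding eq
  proof (rule integral_norm_bound_integral)
    show "(\<lambda>\<sigma>. N (\<gamma> \<sigma>) (\<gamma>' \<sigma>) / lo) integrable_on {0..\<tau>}"
      using integrable_cmul[OF i2, of "1 / lo"] by simp
    show "norm (\<gamma>' \<sigma>) \<le> N (\<gamma> \<sigma>) (\<gamma>' \<sigma>) / lo" for \<sigma>
      using lower[of "\<gamma>' \<sigma>" "\<gamma> \<sigma>"] lo_pos by (simp add: field_simps)
  qed (rule i1)
  then have "lo * norm (\<gamma> \<tau> - \<gamma> 0) \<le> integral {0..\<tau>} (\<lambda>\<sigma>. N (\<gamma> \<sigma>) (\<gamma>' \<sigma>))"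
    using lo_pos by (simp add: field_simps)
  also have "\<dots> \<le> integral {0..1} (\<lambda>\<sigma>. N (\<gamma> \<sigma>) (\<gamma>' \<sigma>))"
    using sub i2 i3 speed_nonneg by (intro integral_subset_le) auto
  finally show ?thesis .
qed

lemma joined_lower: "joined N a b l \<Longrightarrow> lo * norm (b - a) \<le> l"
proof (induction rule: joined.induct)
  case (C1_path \<gamma> \<gamma>' l)
  then show ?case
    using dist_along_path_le[of \<gamma> \<gamma>' 1] by fastforce
next
  case (concat a b l c k)
  have "lo * norm (c - a) \<le> lo * (norm (c - b) + norm (b - a))"
    using lo_pos norm_triangle_ineq[of "c - b" "b - a"] by simp
  then show ?case
    using concat.IH by (simp add: algebra_simps)
qed

lemma joined_segment: "joined N a b (hi * norm (b - a))"
proof -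
  \<comment> \<open>The endpoints are written as values of the segment at 0 and 1, the form in which
    \<open>C1_path\<close> delivers them.\<close>
  have "joined N (a + 0 *\<^sub>R (b - a)) (a + 1 *\<^sub>R (b - a)) (hi * norm (b - a))"
  proof (rule C1_path[where \<gamma>' = "\<lambda>_. b - a"])
    show "((\<lambda>\<sigma>. a + \<sigma> *\<^sub>R (b - a)) has_vector_derivative b - a) (at \<sigma> within {0..1})" for \<sigma>
      by (auto intro!: derivative_eq_intros)
    have "integral {0..1} (\<lambda>\<sigma>. N (a + \<sigma> *\<^sub>R (b - a)) (b - a))
        \<le> integral {0..1::real} (\<lambda>_. hi * norm (b - a))"
      by (intro integral_le speed_integrable upper) (auto intro!: continuous_intros)
    then show "integral {0..1} (\<lambda>\<sigma>. N (a + \<sigma> *\<^sub>R (b - a)) (b - a)) \<le> hi * norm (b - a)"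
      by simp
  qed auto
  then show ?thesis by simp
qed

lemma bdd_below_joined: "bdd_below {l. joined N a b l}"
  using joined_lower by (auto intro!: bdd_belowI[of _ "lo * norm (b - a)"])

lemma geo_dist_le: "joined N a b l \<Longrightarrow> geo_dist N a b \<le> l"
  unfolding geo_dist_def using bdd_below_joined by (auto intro: cInf_lower)

lemma geo_dist_approx:
  assumes "e > 0"
  obtains l where "joined N a b l" "l < geo_dist N a b + e"
proof -
  have "{l. joined N a b l} \<noteq> {}" using joined_segment by blast
  then show ?thesis
    using cInf_lessD[of "{l. joined N a b l}" "geo_dist N a b + e"] assms that
    unfolding geo_dist_def by auto
qed

lemma geo_dist_lower: "lo * norm (b - a) \<le> geo_dist N a b"
proof (rule field_le_epsilon)
  fix e :: real assume "e > 0"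
  then obtain l where "joined N a b l" "l < geo_dist N a b + e" by (rule geo_dist_approx)
  then show "lo * norm (b - a) \<le> geo_dist N a b + e" using joined_lower by force
qed

lemma geo_dist_nonneg: "0 \<le> geo_dist N a b"
  using geo_dist_lower[of b a] lo_pos by (meson dual_order.trans less_imp_le mult_nonneg_nonneg norm_ge_zero)

text \<open>The chain rule compares the two integrands pointwise, but \<open>le\<close> is available
  only on the ball. The budget \<open>dist z a + l / lo \<le> r\<close> guarantees that no curve of
  length at most \<open>l\<close> from \<open>a\<close> leaves it.\<close>

lemma joined_map:
  assumes N': "finsler N' lo' hi'"
    and \<phi>: "\<And>y. (\<phi> has_derivative \<phi>' y) (at y)"
    and \<phi>'_cont: "continuous_on UNIV (\<lambda>(y, v). \<phi>' y v)"
    and le: "\<And>y v. y \<in> cball z r \<Longrightarrow> N' (\<phi> y) (\<phi>' y v) \<le> c * N y v"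
    and c: "c \<ge> 0"
  shows "joined N a b l \<Longrightarrow> dist z a + l / lo \<le> r \<Longrightarrow> joined N' (\<phi> a) (\<phi> b) (c * l)"
proof (induction rule: joined.induct)
  case (C1_path \<gamma> \<gamma>' l)
  interpret N': finsler N' lo' hi' by (rule N')
  have c\<gamma>: "continuous_on {0..1} \<gamma>"
    using C1_path.hyps(1) by (meson continuous_on_eq_continuous_within has_vector_derivative_continuous)
  have c\<phi>: "continuous_on UNIV \<phi>"
    using \<phi> by (meson continuous_at_imp_continuous_on has_derivative_continuous)
  have c\<phi>\<gamma>: "continuous_on {0..1} (\<lambda>\<sigma>. \<phi> (\<gamma> \<sigma>))"
    by (rule continuous_on_compose2[OF c\<phi> c\<gamma>]) auto
  have c\<phi>': "continuous_on {0..1} (\<lambda>\<sigma>. (\<lambda>(y, v). \<phi>' y v) (\<gamma> \<sigma>, \<gamma>' \<sigma>))"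
    by (rule continuous_on_compose2[OF \<phi>'_cont]) (auto intro!: continuous_intros c\<gamma> C1_path.hyps)
  have ball: "\<gamma> \<sigma> \<in> cball z r" if "\<sigma> \<in> {0..1}" for \<sigma>
  proof -
    have "lo * norm (\<gamma> \<sigma> - \<gamma> 0) \<le> l"
      using dist_along_path_le[OF C1_path.hyps(1,2) that] C1_path.hyps(3) by simp
    then have "norm (\<gamma> \<sigma> - \<gamma> 0) \<le> l / lo"
      using lo_pos by (simp add: field_simps)
    then have "dist (\<gamma> 0) (\<gamma> \<sigma>) \<le> l / lo" by (simp add: dist_norm norm_minus_commute)
    then show ?thesis
      using C1_path.prems dist_triangle[of z "\<gamma> \<sigma>" "\<gamma> 0"] by simp
  qed
  show ?case
  proof (rule joined.C1_path[where \<gamma> = "\<lambda>\<sigma>. \<phi> (\<gamma> \<sigma>)" and \<gamma>' = "\<lambda>\<sigma>. \<phi>' (\<gamma> \<sigma>) (\<gamma>' \<sigma>)"])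
    show "((\<lambda>\<sigma>. \<phi> (\<gamma> \<sigma>)) has_vector_derivative \<phi>' (\<gamma> \<sigma>) (\<gamma>' \<sigma>)) (at \<sigma> within {0..1})"
      if "\<sigma> \<in> {0..1}" for \<sigma>
      using vector_derivative_diff_chain_within[OF C1_path.hyps(1)[OF that] has_derivative_at_withinI[OF \<phi>]]
      by (simp add: o_def)
    show "continuous_on {0..1} (\<lambda>\<sigma>. \<phi>' (\<gamma> \<sigma>) (\<gamma>' \<sigma>))" using c\<phi>' by simp
    have "(\<lambda>\<sigma>. c * N (\<gamma> \<sigma>) (\<gamma>' \<sigma>)) integrable_on {0..1}"
      using integrable_cmul[OF speed_integrable[OF c\<gamma> C1_path.hyps(2)], of 0 1 c] by simp
    moreover have "(\<lambda>\<sigma>. N' (\<phi> (\<gamma> \<sigma>)) (\<phi>' (\<gamma> \<sigma>) (\<gamma>' \<sigma>))) integrable_on {0..1}"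
      using c\<phi>' by (intro N'.speed_integrable[OF c\<phi>\<gamma>]) auto
    ultimately have "integral {0..1} (\<lambda>\<sigma>. N' (\<phi> (\<gamma> \<sigma>)) (\<phi>' (\<gamma> \<sigma>) (\<gamma>' \<sigma>)))
        \<le> integral {0..1} (\<lambda>\<sigma>. c * N (\<gamma> \<sigma>) (\<gamma>' \<sigma>))"
      using ball le by (intro integral_le) auto
    also have "\<dots> \<le> c * l"
      using C1_path.hyps(3) c by (simp add: mult_left_mono)
    finally show "integral {0..1} (\<lambda>\<sigma>. N' (\<phi> (\<gamma> \<sigma>)) (\<phi>' (\<gamma> \<sigma>) (\<gamma>' \<sigma>))) \<le> c * l" .
  qed
next
  case (concat a b l b' k)
  have l0: "lo * norm (b - a) \<le> l" and k0: "lo * norm (b' - b) \<le> k"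
    using concat.hyps joined_lower by auto
  have "0 \<le> k / lo"
    using k0 lo_pos by (meson divide_nonneg_pos dual_order.trans less_imp_le mult_nonneg_nonneg norm_ge_zero)
  moreover have "dist a b \<le> l / lo"
    using l0 lo_pos by (simp add: field_simps dist_norm norm_minus_commute)
  \<comment> \<open>The budget splits over the two pieces: the first costs at most l / lo and ends
    within that distance of \<open>a\<close>, which leaves k / lo for the second.\<close>
  ultimately have "dist z a + l / lo \<le> r" "dist z b + k / lo \<le> r"
    using concat.prems dist_triangle[of z b a] by (auto simp: add_divide_distrib)
  then show ?case
    using joined.concat[OF concat.IH] by (simp add: distrib_left)
qed

text \<open>The image of a nearly shortest curve is completed by segments from a' to \<phi> a and
  from \<phi> b to b'. The summand 1 in the radius is room for the excess of that curve over the
  infimum.\<close>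

lemma geo_dist_map_le:
  assumes N': "finsler N' lo' hi'"
    and \<phi>: "\<And>y. (\<phi> has_derivative \<phi>' y) (at y)"
    and \<phi>'_cont: "continuous_on UNIV (\<lambda>(y, v). \<phi>' y v)"
    and le: "\<And>y v. y \<in> cball z r \<Longrightarrow> N' (\<phi> y) (\<phi>' y v) \<le> c * N y v"
    and c: "c \<ge> 0"
    and r: "dist z a + (geo_dist N a b + 1) / lo \<le> r"
  shows "geo_dist N' a' b' \<le> c * geo_dist N a b + hi' * (norm (\<phi> a - a') + norm (b' - \<phi> b))"
proof (rule field_le_epsilon)
  interpret N': finsler N' lo' hi' by (rule N')
  fix e :: real assume e: "e > 0"
  \<comment> \<open>The cap 1 matches the room left in \<open>r\<close>; the denominator is c + 1
    because \<open>c\<close> may vanish.\<close>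
  define \<eta> where "\<eta> = min 1 (e / (c + 1))"
  have \<eta>: "\<eta> > 0" "\<eta> \<le> 1" "c * \<eta> \<le> e"
  proof -
    have "c * \<eta> \<le> (c + 1) * (e / (c + 1))"
      unfolding \<eta>_def using e c by (intro mult_mono) auto
    then show "c * \<eta> \<le> e" using c by simp
  qed (use e c in \<open>auto simp: \<eta>_def\<close>)
  obtain l where l: "joined N a b l" "l < geo_dist N a b + \<eta>"
    using \<eta>(1) by (rule geo_dist_approx)
  have "l / lo \<le> (geo_dist N a b + 1) / lo"
    using l(2) \<eta>(2) lo_pos by (intro divide_right_mono) auto
  then have "joined N' (\<phi> a) (\<phi> b) (c * l)"
    using r by (intro joined_map[OF N' \<phi> \<phi>'_cont le c l(1)]) auto
  then have "joined N' a' b' (hi' * norm (\<phi> a - a') + (c * l + hi' * norm (b' - \<phi> b)))"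
    by (intro joined.concat[OF N'.joined_segment] joined.concat[OF _ N'.joined_segment])
  then have "geo_dist N' a' b' \<le> c * l + hi' * (norm (\<phi> a - a') + norm (b' - \<phi> b))"
    using N'.geo_dist_le by (fastforce simp: algebra_simps)
  moreover have "c * l \<le> c * geo_dist N a b + e"
    using mult_left_mono[OF less_imp_le[OF l(2)] c] \<eta>(3) by (simp add: distrib_left)
  ultimately show "geo_dist N' a' b' \<le> c * geo_dist N a b + hi' * (norm (\<phi> a - a') + norm (b' - \<phi> b)) + e"
    by simp
qed

end

section \<open>A Dini comparison principle\<close>

text \<open>\<open>U\<close> solves U' = b - a U with U 0 = D 0. The times up to which D stays below
  the barrier U t + e (1 + t) form an interval that \<open>left\<close> closes at its supremum and
  \<open>step\<close> extends beyond it. In \<open>left\<close> the \<delta> may depend on a bound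
  \<open>B\<close> for D s, since for geodesic distances the compact set needed depends on such a
  bound.\<close>

lemma dini_comparison:
  fixes D :: "real \<Rightarrow> real"
  assumes a: "a > 0" and T: "0 \<le> T"
    and step: "\<And>t e. 0 \<le> t \<Longrightarrow> t < T \<Longrightarrow> e > 0 \<Longrightarrow>
      \<exists>\<delta>>0. \<forall>s. 0 < s \<and> s < \<delta> \<longrightarrow> D (t + s) \<le> D t + s * (b - a * D t + e)"
    and left: "\<And>t e B. 0 < t \<Longrightarrow> t \<le> T \<Longrightarrow> e > 0 \<Longrightarrow>
      \<exists>\<delta>>0. \<forall>s. 0 \<le> s \<and> t - \<delta> < s \<and> s < t \<and> D s \<le> B \<longrightarrow> D t \<le> D s + e"
  shows "D T \<le> exp (- a * T) * D 0 + b / a * (1 - exp (- a * T))"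
proof (rule field_le_epsilon)
  fix \<epsilon> :: real assume \<epsilon>: "\<epsilon> > 0"
  define U where "U t = exp (- a * t) * D 0 + b / a * (1 - exp (- a * t))" for t
  \<comment> \<open>Chosen so that the slack e (1 + T) of the barrier at the final time is
    \<epsilon>.\<close>
  define e where "e = \<epsilon> / (1 + T)"
  have e: "e > 0" using \<epsilon> T by (simp add: e_def)
  have U_der: "(U has_real_derivative b - a * U t) (at t)" for t
    unfolding U_def using a by (auto intro!: derivative_eq_intros simp: field_simps)
  have U_cont: "continuous_on S U" for S
    unfolding U_def by (intro continuous_intros)
  have U_step: "\<exists>\<delta>>0. \<forall>s. 0 < s \<and> s < \<delta> \<longrightarrow> U (t + s) \<ge> U t + s * (b - a * U t - \<eta>)"
    if "\<eta> > 0" for t \<eta>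
  proof -
    have "((\<lambda>s. (U (t + s) - U t) / s) \<longlongrightarrow> b - a * U t) (at 0)"
      using U_der[of t] by (simp add: DERIV_def)
    then have "\<forall>\<^sub>F s in at 0. (U (t + s) - U t) / s > b - a * U t - \<eta>"
      using that by (intro order_tendstoD) auto
    then obtain \<delta> where "\<delta> > 0" "\<And>s. s \<noteq> 0 \<Longrightarrow> dist s 0 < \<delta> \<Longrightarrow> (U (t + s) - U t) / s > b - a * U t - \<eta>"
      unfolding eventually_at by auto
    moreover have "U (t + s) \<ge> U t + s * (b - a * U t - \<eta>)" if "0 < s" "s < \<delta>" for s
    proof -
      have "b - a * U t - \<eta> < (U (t + s) - U t) / s" using calculation that by simp
      then have "(b - a * U t - \<eta>) * s < U (t + s) - U t"
        using \<open>0 < s\<close> by (simp add: pos_less_divide_eq)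
      then show ?thesis by (simp add: mult.commute)
    qed
    ultimately show ?thesis by blast
  qed
  define A where "A = {t \<in> {0..T}. \<forall>s\<in>{0..t}. D s \<le> U s + e * (1 + s)}"
  have A0: "0 \<in> A" using T e by (auto simp: A_def U_def)
  have bdd: "bdd_above A" by (auto simp: A_def)
  define \<tau> where "\<tau> = Sup A"
  have \<tau>: "0 \<le> \<tau>" "\<tau> \<le> T"
  proof -
    show "0 \<le> \<tau>" unfolding \<tau>_def by (rule cSup_upper[OF A0 bdd])
    show "\<tau> \<le> T" unfolding \<tau>_def by (rule cSup_least) (use A0 in \<open>auto simp: A_def\<close>)
  qed
  have below: "D s \<le> U s + e * (1 + s)" if s: "0 \<le> s" "s < \<tau>" for s
  proof -
    have "A \<noteq> {}" using A0 by blast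
    then obtain t where "t \<in> A" "s < t"
      using less_cSupD[of A s] s(2) unfolding \<tau>_def by blast
    then show ?thesis using s by (auto simp: A_def)
  qed
  have at\<tau>: "D \<tau> \<le> U \<tau> + e * (1 + \<tau>)"
  proof (cases "\<tau> = 0")
    case True
    then show ?thesis using e by (simp add: U_def)
  next
    case False
    then have "\<tau> > 0" using \<tau> by simp
    \<comment> \<open>Before \<tau> the function D lies below the barrier, which is bounded on the
      compact interval; this bound is the \<open>B\<close> handed to \<open>left\<close>.\<close>
    obtain B where B: "\<And>s. s \<in> {0..\<tau>} \<Longrightarrow> U s + e * (1 + s) \<le> B"
    proof -
      have "compact ((\<lambda>s. U s + e * (1 + s)) ` {0..\<tau>})"
        by (intro compact_continuous_image continuous_intros U_cont) auto
      then have "bdd_above ((\<lambda>s. U s + e * (1 + s)) ` {0..\<tau>})"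
        by (intro bounded_imp_bdd_above compact_imp_bounded)
      then show ?thesis using that unfolding bdd_above_def by blast
    qed
    show ?thesis
    proof (rule field_le_epsilon)
      fix \<eta> :: real assume \<eta>: "\<eta> > 0"
      obtain \<delta>1 where \<delta>1: "\<delta>1 > 0" "\<And>s. 0 \<le> s \<Longrightarrow> \<tau> - \<delta>1 < s \<Longrightarrow> s < \<tau> \<Longrightarrow> D s \<le> B \<Longrightarrow> D \<tau> \<le> D s + \<eta> / 2"
        using left[OF \<open>\<tau> > 0\<close> \<tau>(2), of "\<eta> / 2" B] \<eta> by auto
      have "continuous_on UNIV (\<lambda>s. U s + e * (1 + s))"
        by (intro continuous_intros U_cont)
      from this[unfolded continuous_on_iff, rule_format, OF UNIV_I half_gt_zero[OF \<eta>]]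
      obtain \<delta>2 where \<delta>2: "\<delta>2 > 0"
        "\<And>s. dist s \<tau> < \<delta>2 \<Longrightarrow> dist (U s + e * (1 + s)) (U \<tau> + e * (1 + \<tau>)) < \<eta> / 2"
        by blast
      define s where "s = max 0 (\<tau> - min \<delta>1 \<delta>2 / 2)"
      have s: "0 \<le> s" "s < \<tau>" "\<tau> - \<delta>1 < s" "dist s \<tau> < \<delta>2"
        using \<open>\<tau> > 0\<close> \<delta>1(1) \<delta>2(1) by (auto simp: s_def dist_real_def)
      have "D s \<le> U s + e * (1 + s)" using below s by simp
      moreover have "D s \<le> B" using calculation B[of s] s by simp
      then have "D \<tau> \<le> D s + \<eta> / 2" using \<delta>1(2) s by simp
      moreover have "U s + e * (1 + s) \<le> U \<tau> + e * (1 + \<tau>) + \<eta> / 2"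
        using \<delta>2(2)[OF s(4)] unfolding dist_real_def by linarith
      ultimately show "D \<tau> \<le> U \<tau> + e * (1 + \<tau>) + \<eta>" by simp
    qed
  qed
  have "\<tau> = T"
  proof (rule ccontr)
    assume "\<tau> \<noteq> T"
    then have lt: "\<tau> < T" using \<tau> by simp
    \<comment> \<open>The errors e / 2 for D and for U add up to e, the slope of the slack in the
      barrier.\<close>
    obtain \<delta>1 where \<delta>1: "\<delta>1 > 0" "\<And>s. 0 < s \<Longrightarrow> s < \<delta>1 \<Longrightarrow> D (\<tau> + s) \<le> D \<tau> + s * (b - a * D \<tau> + e / 2)"
      using step[OF \<tau>(1) lt, of "e / 2"] e by auto
    obtain \<delta>2 where \<delta>2: "\<delta>2 > 0" "\<And>s. 0 < s \<Longrightarrow> s < \<delta>2 \<Longrightarrow> U (\<tau> + s) \<ge> U \<tau> + s * (b - a * U \<tau> - e / 2)"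
      using U_step[of "e / 2" \<tau>] e by auto
    \<comment> \<open>The bound 1 / a keeps 1 - a r positive below, and T - \<tau> keeps the
      extended interval inside [0, T].\<close>
    define m where "m = min (min \<delta>1 \<delta>2) (min (1 / a) (T - \<tau>))"
    have "m > 0" using \<delta>1 \<delta>2 a lt by (simp add: m_def)
    moreover define \<delta> where "\<delta> = m / 2"
    ultimately have \<delta>: "\<delta> > 0" "\<delta> < m" by auto
    then have \<delta>: "\<delta> > 0" "\<delta> < \<delta>1" "\<delta> < \<delta>2" "\<delta> < 1 / a" "\<delta> < T - \<tau>"
      unfolding m_def by auto
    have "D s \<le> U s + e * (1 + s)" if "s \<in> {0..\<tau> + \<delta>}" for s
    proof -
      consider "s < \<tau>" | "s = \<tau>" | "s > \<tau>" by linarith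
      then show ?thesis
      proof cases
        case 3
        define r where "r = s - \<tau>"
        have r: "0 < r" "r < \<delta>1" "r < \<delta>2" "r < 1 / a" "s = \<tau> + r"
          using 3 that \<delta> by (auto simp: r_def)
        have "a * r < 1" using r(4) a by (simp add: field_simps)
        \<comment> \<open>The terms with b cancel in the difference, which leaves the contraction
          factor 1 - a r.\<close>
        have "D s - U s \<le> (1 - a * r) * (D \<tau> - U \<tau>) + r * e"
          using \<delta>1(2)[OF r(1,2)] \<delta>2(2)[OF r(1,3)] r(5) by (simp add: algebra_simps)
        also have "\<dots> \<le> (1 - a * r) * (e * (1 + \<tau>)) + r * e"
          using at\<tau> \<open>a * r < 1\<close> by (intro add_right_mono mult_left_mono) auto
        also have "\<dots> \<le> 1 * (e * (1 + \<tau>)) + r * e"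
          using a r(1) e \<tau>(1) by (intro add_right_mono mult_right_mono) auto
        also have "\<dots> = e * (1 + s)" using r(5) by (simp add: algebra_simps)
        finally show ?thesis by simp
      qed (use that below at\<tau> in auto)
    qed
    then have "\<tau> + \<delta> \<in> A" using \<delta> \<tau> by (auto simp: A_def)
    then have "\<tau> + \<delta> \<le> \<tau>" unfolding \<tau>_def using bdd by (rule cSup_upper)
    then show False using \<delta>(1) by simp
  qed
  then have "D T \<le> U T + e * (1 + T)" using at\<tau> by simp
  also have "e * (1 + T) = \<epsilon>" using T by (simp add: e_def)
  finally show "D T \<le> exp (- a * T) * D 0 + b / a * (1 - exp (- a * T)) + \<epsilon>"
    by (simp add: U_def)
qed

section \<open>Time-varying Riemannian metrics\<close>

text \<open>For M = \<Theta>^T \<Theta> this is the norm of \<Theta> v. It is written with M because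
  smoothness is assumed for M, whereas \<Theta> is an arbitrary factor.\<close>

definition speed :: "(real^'n \<Rightarrow> real \<Rightarrow> real^'n^'n) \<Rightarrow> real \<Rightarrow> real^'n \<Rightarrow> real^'n \<Rightarrow> real" where
  "speed M t y v = sqrt (v \<bullet> (M y t *v v))"

lemma bounded_bilinear_matrix_vector_mult:
  "bounded_bilinear (\<lambda>(A::real^'n^'m) (v::real^'n). A *v v)"
  unfolding bilinear_conv_bounded_bilinear[symmetric] bilinear_def
  by (auto intro!: linearI simp: matrix_vector_mult_add_rdistrib matrix_vector_right_distrib
      scaleR_matrix_vector_assoc matrix_vector_mult_scaleR)

lemmas continuous_on_matrix_vector_mult [continuous_intros] =
  bounded_bilinear.continuous_on[OF bounded_bilinear_matrix_vector_mult]

text \<open>Expansion of \<open>w p\<close> in the basis. \<open>Ck_on\<close> gives continuity of a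
  derivative only in each fixed direction; this turns it into continuity with a varying
  direction.\<close>

lemma continuous_on_linear_family:
  fixes L :: "'p::topological_space \<Rightarrow> 'a::euclidean_space \<Rightarrow> 'b::real_normed_vector"
  assumes lin: "\<And>p. p \<in> S \<Longrightarrow> linear (L p)"
    and cont: "\<And>v. continuous_on S (\<lambda>p. L p v)" and w: "continuous_on S w"
  shows "continuous_on S (\<lambda>p. L p (w p))"
proof -
  have "continuous_on S (\<lambda>p. \<Sum>i\<in>Basis. (w p \<bullet> i) *\<^sub>R L p i)"
    by (intro continuous_intros cont w)
  moreover have "L p (w p) = (\<Sum>i\<in>Basis. (w p \<bullet> i) *\<^sub>R L p i)" if "p \<in> S" for p
    using lin[OF that] by (subst euclidean_representation[symmetric, of "w p"])
      (simp only: linear_sum linear_cmul)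
  ultimately show ?thesis by (simp cong: continuous_on_cong)
qed

text \<open>The mean value theorem in s gives \<Phi>' at some intermediate time, and uniform
  continuity on the compact product moves that time to 0 with one \<delta> for all z.\<close>

lemma uniform_first_order_bound:
  fixes \<Phi> :: "real \<Rightarrow> 'a::metric_space \<Rightarrow> real"
  assumes Z: "compact Z"
    and der: "\<And>s z. s \<in> {0..1} \<Longrightarrow> z \<in> Z \<Longrightarrow>
      ((\<lambda>s. \<Phi> s z) has_vector_derivative \<Phi>' (s, z)) (at s within {0..1})"
    and cont: "continuous_on ({0..1} \<times> Z) \<Phi>'"
    and e: "e > 0"
  shows "\<exists>\<delta>>0. \<forall>s\<in>{0..\<delta>}. \<forall>z\<in>Z. \<Phi> s z \<le> \<Phi> 0 z + s * (\<Phi>' (0, z) + e)"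
proof -
  have "uniformly_continuous_on ({0..1} \<times> Z) \<Phi>'"
    using cont Z by (intro compact_uniformly_continuous compact_Times) auto
  then obtain \<delta> where \<delta>: "\<delta> > 0"
    "\<And>p p'. p \<in> {0..1} \<times> Z \<Longrightarrow> p' \<in> {0..1} \<times> Z \<Longrightarrow> dist p' p < \<delta> \<Longrightarrow> dist (\<Phi>' p') (\<Phi>' p) < e"
    using e unfolding uniformly_continuous_on_def by meson
  have "\<Phi> s z \<le> \<Phi> 0 z + s * (\<Phi>' (0, z) + e)" if s: "s \<in> {0..min 1 (\<delta> / 2)}" and z: "z \<in> Z" for s z
  proof -
    have "\<exists>\<xi>\<in>{0..s}. \<Phi> s z - \<Phi> 0 z = (\<lambda>h. h * \<Phi>' (\<xi>, z)) (s - 0)"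
    proof (rule mvt_very_simple)
      show "((\<lambda>s. \<Phi> s z) has_derivative (\<lambda>h. h * \<Phi>' (r, z))) (at r within {0..s})"
        if "0 \<le> r" "r \<le> s" for r
        using has_vector_derivative_within_subset[OF der[of r z], of "{0..s}"] that s z
        by (auto simp: has_vector_derivative_def)
    qed (use s in auto)
    then obtain \<xi> where \<xi>: "\<xi> \<in> {0..s}" "\<Phi> s z = \<Phi> 0 z + s * \<Phi>' (\<xi>, z)"
      by (auto simp: algebra_simps)
    have "dist (\<Phi>' (\<xi>, z)) (\<Phi>' (0, z)) < e"
      using \<xi> s z \<delta>(1) by (intro \<delta>(2)) (auto simp: dist_Pair_Pair)
    then have "\<Phi>' (\<xi>, z) \<le> \<Phi>' (0, z) + e" by (simp add: dist_real_def)
    then show ?thesis using \<xi> s by (simp add: mult_left_mono)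
  qed
  then show ?thesis using \<delta>(1) by (intro exI[of _ "min 1 (\<delta> / 2)"]) auto
qed

lemma quadratic_form_scaleR: "(c *\<^sub>R v) \<bullet> (A *v (c *\<^sub>R v)) = c\<^sup>2 * (v \<bullet> (A *v v))"
  for A :: "real^'n^'n"
  by (simp add: matrix_vector_mult_scaleR power2_eq_square)

text \<open>Both sides have degree 2 in v, so compactness arguments may be confined to the unit
  sphere.\<close>

lemma quadratic_form_le_homogeneous:
  fixes A B :: "real^'n^'n"
  assumes L: "linear L"
    and unit: "\<And>v. norm v = 1 \<Longrightarrow> L v \<bullet> (A *v L v) \<le> c * (v \<bullet> (B *v v))"
  shows "L v \<bullet> (A *v L v) \<le> c * (v \<bullet> (B *v v))"
proof (cases "v = 0")
  case True
  then show ?thesis using linear_0[OF L] by simp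
next
  case False
  define u where "u = (1 / norm v) *\<^sub>R v"
  have u: "norm u = 1" "v = norm v *\<^sub>R u" using False by (auto simp: u_def)
  have "L v = norm v *\<^sub>R L u"
    using linear_cmul[OF L, of "norm v" u] unfolding u(2)[symmetric] .
  then have "L v \<bullet> (A *v L v) = (norm v)\<^sup>2 * (L u \<bullet> (A *v L u))"
    by (simp only: quadratic_form_scaleR)
  also have "\<dots> \<le> (norm v)\<^sup>2 * (c * (u \<bullet> (B *v u)))"
    by (intro mult_left_mono unit u) simp
  also have "\<dots> = c * (v \<bullet> (B *v v))"
    using quadratic_form_scaleR[of "norm v" u B] unfolding u(2)[symmetric] by simp
  finally show ?thesis .
qed

text \<open>\<open>DM\<close> is the joint derivative in space and time, one-sided at time 0;
  \<open>DM (y, t) (w, 1)\<close> is the rate of change of M along the velocity w.\<close>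

locale time_metric =
  fixes M :: "real^'n \<Rightarrow> real \<Rightarrow> real^'n^'n" and DM lo hi
  assumes M_deriv: "\<And>p. p \<in> UNIV \<times> {0..} \<Longrightarrow>
      ((\<lambda>(y, t). M y t) has_derivative DM p) (at p within UNIV \<times> {0..})"
    and DM_cont: "\<And>w. continuous_on (UNIV \<times> {0..}) (\<lambda>p. DM p w)"
    and M_sym: "t \<ge> 0 \<Longrightarrow> transpose (M y t) = M y t"
    and lo_pos: "lo > 0"
    and M_lower: "t \<ge> 0 \<Longrightarrow> lo * (norm v)\<^sup>2 \<le> v \<bullet> (M y t *v v)"
    and M_upper: "t \<ge> 0 \<Longrightarrow> v \<bullet> (M y t *v v) \<le> hi * (norm v)\<^sup>2"
begin

lemma hi_pos: "hi > 0"
proof -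
  have "lo \<le> hi"
    using M_lower[of 0 "axis (undefined::'n) 1" 0] M_upper[of 0 "axis (undefined::'n) 1" 0]
    by (simp add: norm_axis_1)
  then show ?thesis using lo_pos by simp
qed

lemma continuous_M:
  assumes "continuous_on S p" "continuous_on S r" "\<And>z. z \<in> S \<Longrightarrow> r z \<ge> 0"
  shows "continuous_on S (\<lambda>z. M (p z) (r z))"
proof -
  have "continuous_on (UNIV \<times> {0..}) (\<lambda>(y, t). M y t)"
    by (rule has_derivative_continuous_on[OF M_deriv])
  then have "continuous_on S (\<lambda>z. (\<lambda>(y, t). M y t) (p z, r z))"
    by (rule continuous_on_compose2) (use assms in \<open>auto intro!: continuous_intros\<close>)
  then show ?thesis by simp
qed

lemma continuous_DM:
  assumes "continuous_on S p" "continuous_on S r" "\<And>z. z \<in> S \<Longrightarrow> r z \<ge> 0" "continuous_on S w"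
  shows "continuous_on S (\<lambda>z. DM (p z, r z) (w z))"
proof (rule continuous_on_linear_family[where L = "\<lambda>z. DM (p z, r z)"])
  show "linear (DM (p z, r z))" if "z \<in> S" for z
    using M_deriv[of "(p z, r z)"] assms(3)[OF that] by (intro has_derivative_linear) auto
  show "continuous_on S (\<lambda>z. DM (p z, r z) v)" for v
    by (rule continuous_on_compose2[OF DM_cont]) (use assms in \<open>auto intro!: continuous_intros\<close>)
qed (rule assms(4))

lemma finsler_speed:
  assumes "t \<ge> 0"
  shows "finsler (speed M t) (sqrt lo) (sqrt hi)"
proof
  show "continuous_on UNIV (\<lambda>(y, v). speed M t y v)"
    unfolding speed_def case_prod_beta
    using assms by (intro continuous_intros continuous_M) auto
  show "sqrt lo > 0" using lo_pos by simp
  show "sqrt lo * norm v \<le> speed M t y v" for v y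
    using real_sqrt_le_mono[OF M_lower[OF assms, of v y]] by (simp add: speed_def real_sqrt_mult)
  show "speed M t y v \<le> sqrt hi * norm v" for v y
    using real_sqrt_le_mono[OF M_upper[OF assms, of v y]] by (simp add: speed_def real_sqrt_mult)
qed

text \<open>At s = 0 the derivative of the squared speed of the pushed vector is the left-hand side
  of \<open>contr\<close>. The rate 2\<alpha> for the square becomes \<alpha> for the speed.\<close>

lemma speed_flow_step:
  assumes f: "\<And>y. (f has_derivative Df y) (at y)"
    and Df: "\<And>v. continuous_on UNIV (\<lambda>y. Df y v)"
    and t: "t \<ge> 0" and \<alpha>: "\<alpha> > 0" and e: "e > 0" and K: "compact K"
    and contr: "\<And>y v. v \<bullet> (DM (y, t) (f y, 1) *v v) + 2 * (v \<bullet> (M y t *v Df y v))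
      \<le> - 2 * \<alpha> * (v \<bullet> (M y t *v v))"
  shows "\<exists>\<delta>>0. \<forall>s\<in>{0..\<delta>}. \<forall>y\<in>K. \<forall>v.
    speed M (t + s) (y + s *\<^sub>R f y) (v + s *\<^sub>R Df y v) \<le> (1 - \<alpha> * s + e * s) * speed M t y v"
proof -
  define w where "w = (\<lambda>s y v. v + s *\<^sub>R Df y v)"
  define \<Phi> where "\<Phi> = (\<lambda>s (y, v). w s y v \<bullet> (M (y + s *\<^sub>R f y) (t + s) *v w s y v))"
  define \<Phi>' where "\<Phi>' = (\<lambda>(s, y, v). 
     w s y v \<bullet> (M (y + s *\<^sub>R f y) (t + s) *v Df y v + DM (y + s *\<^sub>R f y, t + s) (f y, 1) *v w s y v)
     + Df y v \<bullet> (M (y + s *\<^sub>R f y) (t + s) *v w s y v))"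
  have f_cont: "continuous_on UNIV f"
    using f by (meson continuous_at_imp_continuous_on has_derivative_continuous)
  have Df_cont: "continuous_on S (\<lambda>z. Df (p z) (u z))"
    if "continuous_on S p" "continuous_on S u" for S :: "(real \<times> (real^'n) \<times> (real^'n)) set" and p u
  proof (rule continuous_on_linear_family[where L = "\<lambda>z. Df (p z)"])
    show "linear (Df (p z))" for z using f by (rule has_derivative_linear)
    show "continuous_on S (\<lambda>z. Df (p z) v)" for v
      by (rule continuous_on_compose2[OF Df that(1)]) auto
  qed (rule that)
  have der: "((\<lambda>s. \<Phi> s z) has_vector_derivative \<Phi>' (s, z)) (at s within {0..1})"
    if s: "s \<in> {0..1}" for s z
  proof -
    obtain y v where z: "z = (y, v)" by (cases z)
    have p: "((\<lambda>s. (y + s *\<^sub>R f y, t + s)) has_derivative (\<lambda>h. (h *\<^sub>R f y, h))) (at s within {0..1})"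
      by (auto intro!: derivative_eq_intros)
    have "((\<lambda>s. (\<lambda>(y, t). M y t) (y + s *\<^sub>R f y, t + s)) has_derivative
        (\<lambda>h. DM (y + s *\<^sub>R f y, t + s) (h *\<^sub>R f y, h))) (at s within {0..1})"
      by (rule has_derivative_in_compose2[OF M_deriv _ s p]) (use t in auto)
    moreover have "DM (y + s *\<^sub>R f y, t + s) (h *\<^sub>R f y, h) = h *\<^sub>R DM (y + s *\<^sub>R f y, t + s) (f y, 1)" for h
    proof -
      have "linear (DM (y + s *\<^sub>R f y, t + s))"
        using M_deriv[of "(y + s *\<^sub>R f y, t + s)"] s t by (intro has_derivative_linear) auto
      from linear_cmul[OF this, of h "(f y, 1)"] show ?thesis by simp
    qed
    ultimately have 1: "((\<lambda>s. M (y + s *\<^sub>R f y) (t + s)) has_vector_derivative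
        DM (y + s *\<^sub>R f y, t + s) (f y, 1)) (at s within {0..1})"
      by (simp add: has_vector_derivative_def)
    have 2: "((\<lambda>s. w s y v) has_vector_derivative Df y v) (at s within {0..1})"
      unfolding w_def by (auto intro!: derivative_eq_intros)
    show ?thesis
      unfolding \<Phi>_def \<Phi>'_def z prod.case
      by (intro bounded_bilinear.has_vector_derivative[OF bounded_bilinear_inner]
          bounded_bilinear.has_vector_derivative[OF bounded_bilinear_matrix_vector_mult] 1 2)
  qed
  have cont: "continuous_on ({0..1} \<times> (K \<times> sphere 0 1)) \<Phi>'"
    unfolding \<Phi>'_def w_def case_prod_beta
    using t by (intro continuous_intros continuous_M continuous_DM Df_cont
        continuous_on_compose2[OF f_cont]) auto
  have "compact (K \<times> sphere (0::real^'n) 1)" using K by (intro compact_Times) auto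
  \<comment> \<open>On the unit sphere \<open>lo\<close> is at most the quadratic form, so the
    additive error 2 e lo turns into a relative error 2 e.\<close>
  from uniform_first_order_bound[OF this der cont, of "2 * e * lo"] e lo_pos
  obtain \<delta> where \<delta>: "\<delta> > 0" "\<And>s z. s \<in> {0..\<delta>} \<Longrightarrow> z \<in> K \<times> sphere 0 1 \<Longrightarrow>
      \<Phi> s z \<le> \<Phi> 0 z + s * (\<Phi>' (0, z) + 2 * e * lo)"
    by auto
  have "speed M (t + s) (y + s *\<^sub>R f y) (w s y v) \<le> (1 - \<alpha> * s + e * s) * speed M t y v"
    if s: "s \<in> {0..min \<delta> (1 / \<alpha>)}" and y: "y \<in> K" for s y v
  proof -
    have unit: "w s y v \<bullet> (M (y + s *\<^sub>R f y) (t + s) *v w s y v) 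
        \<le> (1 + 2 * (e - \<alpha>) * s) * (v \<bullet> (M y t *v v))" if v: "norm v = 1" for v
    proof -
      have "Df y v \<bullet> (M y t *v v) = v \<bullet> (M y t *v Df y v)"
        using dot_lmul_matrix[of "Df y v" "M y t" v] M_sym[OF t, of y]
        by (metis inner_commute transpose_matrix_vector)
      then have "\<Phi>' (0, y, v) = v \<bullet> (DM (y, t) (f y, 1) *v v) + 2 * (v \<bullet> (M y t *v Df y v))"
        by (simp add: \<Phi>'_def w_def inner_add_right)
      also have "\<dots> \<le> - 2 * \<alpha> * (v \<bullet> (M y t *v v))" by (rule contr)
      finally have "\<Phi>' (0, y, v) \<le> - 2 * \<alpha> * (v \<bullet> (M y t *v v))" .
      moreover have "2 * e * lo \<le> 2 * e * (v \<bullet> (M y t *v v))"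
        using M_lower[OF t, of v y] e v by (intro mult_left_mono) auto
      moreover have "2 * (e - \<alpha>) * (v \<bullet> (M y t *v v))
          = 2 * e * (v \<bullet> (M y t *v v)) + - 2 * \<alpha> * (v \<bullet> (M y t *v v))"
        by (simp add: algebra_simps)
      ultimately have "\<Phi>' (0, y, v) + 2 * e * lo \<le> 2 * (e - \<alpha>) * (v \<bullet> (M y t *v v))"
        by linarith
      then have "s * (\<Phi>' (0, y, v) + 2 * e * lo) \<le> s * (2 * (e - \<alpha>) * (v \<bullet> (M y t *v v)))"
        using s by (intro mult_left_mono) auto
      moreover have "\<Phi> s (y, v) \<le> \<Phi> 0 (y, v) + s * (\<Phi>' (0, y, v) + 2 * e * lo)"
        using s y v by (intro \<delta>(2)) auto
      moreover have "\<Phi> 0 (y, v) = v \<bullet> (M y t *v v)" by (simp add: \<Phi>_def w_def)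
      moreover have "\<Phi> s (y, v) = w s y v \<bullet> (M (y + s *\<^sub>R f y) (t + s) *v w s y v)"
        by (simp add: \<Phi>_def)
      ultimately show ?thesis by (simp add: algebra_simps)
    qed
    have "linear (w s y)"
      unfolding w_def using has_derivative_linear[OF f[of y]]
      by (intro linear_compose_add linear_compose_scale_right) (auto simp: linear_ident)
    then have "w s y v \<bullet> (M (y + s *\<^sub>R f y) (t + s) *v w s y v) 
        \<le> (1 + 2 * (e - \<alpha>) * s) * (v \<bullet> (M y t *v v))"
      by (rule quadratic_form_le_homogeneous) (rule unit)
    \<comment> \<open>Completing the square only adds ((e - \<alpha>) s)^2, so no second-order error
      has to be absorbed. The restriction s \<le> 1 / \<alpha> makes the base nonnegative, and the
      root returns it.\<close>
    also have "\<dots> \<le> (1 - \<alpha> * s + e * s)\<^sup>2 * (v \<bullet> (M y t *v v))"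
    proof (rule mult_right_mono)
      have "(1 - \<alpha> * s + e * s)\<^sup>2 = 1 + 2 * (e - \<alpha>) * s + ((e - \<alpha>) * s)\<^sup>2"
        by (simp add: power2_eq_square algebra_simps)
      then show "1 + 2 * (e - \<alpha>) * s \<le> (1 - \<alpha> * s + e * s)\<^sup>2" by simp
      show "0 \<le> v \<bullet> (M y t *v v)"
        using M_lower[OF t, of v y] lo_pos by (smt (verit) mult_nonneg_nonneg zero_le_power2)
    qed
    finally have "speed M (t + s) (y + s *\<^sub>R f y) (w s y v)
        \<le> sqrt ((1 - \<alpha> * s + e * s)\<^sup>2 * (v \<bullet> (M y t *v v)))"
      unfolding speed_def by (rule real_sqrt_le_mono)
    moreover have "0 \<le> 1 - \<alpha> * s + e * s"
    proof -
      have "\<alpha> * s \<le> 1" using s \<alpha> by (simp add: field_simps)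
      moreover have "0 \<le> e * s" using s e by simp
      ultimately show ?thesis by linarith
    qed
    ultimately show ?thesis by (simp add: speed_def real_sqrt_mult)
  qed
  then show ?thesis
    using \<delta>(1) \<alpha> unfolding w_def by (intro exI[of _ "min \<delta> (1 / \<alpha>)"]) auto
qed

text \<open>Uniform continuity gives an additive error e lo on the unit sphere, which is relative
  because \<open>lo\<close> bounds the form from below. The window up to t + 1 makes the set of
  times compact.\<close>

lemma speed_time_continuity:
  assumes t: "t \<ge> 0" and e: "e > 0" and K: "compact K"
  shows "\<exists>\<delta>>0. \<forall>s. 0 \<le> s \<and> \<bar>s - t\<bar> < \<delta> \<longrightarrow> (\<forall>y\<in>K. \<forall>v. speed M t y v \<le> (1 + e) * speed M s y v)"
proof -
  define Q where "Q = (\<lambda>(s, y, v). v \<bullet> (M y s *v v))"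
  have "continuous_on ({0..t+1} \<times> K \<times> sphere 0 1) Q"
    unfolding Q_def case_prod_beta by (intro continuous_intros continuous_M) auto
  then have "uniformly_continuous_on ({0..t+1} \<times> K \<times> sphere 0 1) Q"
    using K by (intro compact_uniformly_continuous compact_Times) auto
  moreover have "e * lo > 0" using e lo_pos by simp
  ultimately obtain \<delta> where \<delta>: "\<delta> > 0"
    "\<And>p p'. p \<in> {0..t+1} \<times> K \<times> sphere 0 1 \<Longrightarrow> p' \<in> {0..t+1} \<times> K \<times> sphere 0 1 \<Longrightarrow>
      dist p' p < \<delta> \<Longrightarrow> dist (Q p') (Q p) < e * lo"
    unfolding uniformly_continuous_on_def by meson
  have "speed M t y v \<le> (1 + e) * speed M s y v"
    if s: "0 \<le> s" "\<bar>s - t\<bar> < min \<delta> 1" and y: "y \<in> K" for s y v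
  proof -
    have unit: "v \<bullet> (M y t *v v) \<le> (1 + e) * (v \<bullet> (M y s *v v))" if v: "norm v = 1" for v
    proof -
      have "dist (Q (t, y, v)) (Q (s, y, v)) < e * lo"
        using s t y v by (intro \<delta>(2)) (auto simp: dist_Pair_Pair dist_real_def)
      then have "v \<bullet> (M y t *v v) \<le> v \<bullet> (M y s *v v) + e * lo"
        by (simp add: Q_def dist_real_def)
      also have "e * lo \<le> e * (v \<bullet> (M y s *v v))"
        using M_lower[OF s(1), of v y] v e by (intro mult_left_mono) auto
      finally show ?thesis by (simp add: algebra_simps)
    qed
    have nn: "0 \<le> v \<bullet> (M y s *v v)"
      using M_lower[OF s(1), of v y] lo_pos by (smt (verit) mult_nonneg_nonneg zero_le_power2)
    have "v \<bullet> (M y t *v v) \<le> (1 + e) * (v \<bullet> (M y s *v v))"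
      by (rule quadratic_form_le_homogeneous[OF linear_ident unit])
    also have "\<dots> \<le> (1 + e)\<^sup>2 * (v \<bullet> (M y s *v v))"
      using e nn by (intro mult_right_mono) (auto simp: power2_eq_square algebra_simps)
    finally have "speed M t y v \<le> sqrt ((1 + e)\<^sup>2 * (v \<bullet> (M y s *v v)))"
      unfolding speed_def by (rule real_sqrt_le_mono)
    then show ?thesis using e by (simp add: speed_def real_sqrt_mult)
  qed
  then show ?thesis using \<delta>(1) by (intro exI[of _ "min \<delta> 1"]) auto
qed

end

section \<open>Evolution of the distance between two moving points\<close>

lemma right_derivative_bound:
  fixes p :: "real \<Rightarrow> 'a::real_normed_vector"
  assumes "(p has_vector_derivative p') (at t within {0..})" and t: "t \<ge> 0" and e: "e > 0"
  shows "\<exists>\<delta>>0. \<forall>s. 0 < s \<and> s < \<delta> \<longrightarrow> norm (p (t + s) - p t - s *\<^sub>R p') \<le> e * s"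
proof -
  obtain \<delta> where \<delta>: "\<delta> > 0"
    "\<And>y. y \<in> {0..} \<Longrightarrow> norm (y - t) < \<delta> \<Longrightarrow> norm (p y - p t - (y - t) *\<^sub>R p') \<le> e * norm (y - t)"
    using assms(1) e unfolding has_vector_derivative_def has_derivative_within_alt by meson
  have "norm (p (t + s) - p t - s *\<^sub>R p') \<le> e * s" if "0 < s" "s < \<delta>" for s
    using \<delta>(2)[of "t + s"] that t by simp
  then show ?thesis using \<delta>(1) by blast
qed

context time_metric
begin

text \<open>The identity carries a curve from the metric at s to the metric at t, and short segments
  correct the endpoints. The bound \<open>B\<close> is used twice: it fixes a ball for all s at
  once, and it makes the relative error \<eta> an absolute one.\<close>

lemma geo_dist_left_semicontinuous:
  assumes t: "t > 0" and e: "e > 0"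
    and xd: "continuous_on {0..t} xd" and x: "continuous_on {0..t} x"
  shows "\<exists>\<delta>>0. \<forall>s. 0 \<le> s \<and> t - \<delta> < s \<and> s < t \<and> geo_dist (speed M s) (xd s) (x s) \<le> B \<longrightarrow>
    geo_dist (speed M t) (xd t) (x t) \<le> geo_dist (speed M s) (xd s) (x s) + e"
proof -
  have "bounded (xd ` {0..t})"
    by (intro compact_imp_bounded compact_continuous_image xd) simp
  then obtain b where b: "\<And>s. s \<in> {0..t} \<Longrightarrow> norm (xd s) \<le> b"
    unfolding bounded_iff by blast
  \<comment> \<open>A ball about 0 that contains the nearly shortest curves from xd s for every s
    considered; b bounds the starting points.\<close>
  define r where "r = b + (B + 1) / sqrt lo"
  \<comment> \<open>The metric change costs \<eta> |B| \<le> e / 2 and each endpoint costs at most e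
    / 4. Adding 1 keeps the denominators positive.\<close>
  define \<eta> where "\<eta> = e / 2 / (\<bar>B\<bar> + 1)"
  define \<kappa> where "\<kappa> = e / 4 / (\<bar>sqrt hi\<bar> + 1)"
  have \<eta>: "\<eta> > 0" "\<eta> * \<bar>B\<bar> \<le> e / 2" and \<kappa>: "\<kappa> > 0" "sqrt hi * \<kappa> \<le> e / 4"
  proof -
    have cancel: "p / (\<bar>c\<bar> + 1) * (\<bar>c\<bar> + 1) = p" for p c :: real
      by (smt (verit) nonzero_eq_divide_eq)
    show "\<eta> > 0" "\<kappa> > 0" using e by (auto simp: \<eta>_def \<kappa>_def)
    then have "\<eta> * \<bar>B\<bar> \<le> \<eta> * (\<bar>B\<bar> + 1)" "sqrt hi * \<kappa> \<le> (\<bar>sqrt hi\<bar> + 1) * \<kappa>"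
      by (intro mult_left_mono mult_right_mono; simp)+
    moreover have "\<eta> * (\<bar>B\<bar> + 1) = e / 2" "(\<bar>sqrt hi\<bar> + 1) * \<kappa> = e / 4"
      using cancel[of "e / 2" B] cancel[of "e / 4" "sqrt hi"]
      unfolding \<eta>_def \<kappa>_def by (simp_all only: mult.commute)
    ultimately show "\<eta> * \<bar>B\<bar> \<le> e / 2" "sqrt hi * \<kappa> \<le> e / 4" by linarith+
  qed
  obtain \<delta>1 where \<delta>1: "\<delta>1 > 0" "\<And>s y v. 0 \<le> s \<Longrightarrow> \<bar>s - t\<bar> < \<delta>1 \<Longrightarrow> y \<in> cball 0 r \<Longrightarrow>
      speed M t y v \<le> (1 + \<eta>) * speed M s y v"
    using speed_time_continuity[of t \<eta> "cball 0 r"] t \<eta>(1) by fastforce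
  have tt: "t \<in> {0..t}" using t by simp
  obtain \<delta>2 where \<delta>2: "\<delta>2 > 0" "\<And>s. s \<in> {0..t} \<Longrightarrow> dist s t < \<delta>2 \<Longrightarrow> dist (xd s) (xd t) < \<kappa>"
    using xd[unfolded continuous_on_iff, rule_format, OF tt \<kappa>(1)] by blast
  obtain \<delta>3 where \<delta>3: "\<delta>3 > 0" "\<And>s. s \<in> {0..t} \<Longrightarrow> dist s t < \<delta>3 \<Longrightarrow> dist (x s) (x t) < \<kappa>"
    using x[unfolded continuous_on_iff, rule_format, OF tt \<kappa>(1)] by blast
  have "geo_dist (speed M t) (xd t) (x t) \<le> geo_dist (speed M s) (xd s) (x s) + e"
    if s: "0 \<le> s" "t - min \<delta>1 (min \<delta>2 \<delta>3) < s" "s < t"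
      and Ds: "geo_dist (speed M s) (xd s) (x s) \<le> B" for s
  proof -
    let ?D = "geo_dist (speed M s) (xd s) (x s)"
    interpret Fs: finsler "speed M s" "sqrt lo" "sqrt hi" using s(1) by (rule finsler_speed)
    interpret Ft: finsler "speed M t" "sqrt lo" "sqrt hi" using t by (intro finsler_speed) simp
    have "(?D + 1) / sqrt lo \<le> (B + 1) / sqrt lo"
      using Ds Fs.lo_pos by (intro divide_right_mono) auto
    then have r: "dist 0 (xd s) + (?D + 1) / sqrt lo \<le> r"
      using b[of s] s by (simp add: r_def)
    have "geo_dist (speed M t) (xd t) (x t)
        \<le> (1 + \<eta>) * ?D + sqrt hi * (norm (xd s - xd t) + norm (x t - x s))"
    proof (rule Fs.geo_dist_map_le[where \<phi> = "\<lambda>y. y" and \<phi>' = "\<lambda>y v. v", OF Ft.finsler_axioms _ _ _ _ r])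
      show "continuous_on UNIV (\<lambda>(y, v). v :: real^'n)"
        unfolding case_prod_beta by (intro continuous_intros)
      show "speed M t y v \<le> (1 + \<eta>) * speed M s y v" if "y \<in> cball 0 r" for y v
        using s that by (intro \<delta>1(2)) auto
    qed (use \<eta>(1) in auto)
    also have "\<dots> \<le> (1 + \<eta>) * ?D + sqrt hi * (\<kappa> + \<kappa>)"
    proof -
      have "0 \<le> sqrt hi" using hi_pos by simp
      moreover have "norm (xd s - xd t) \<le> \<kappa>" "norm (x t - x s) \<le> \<kappa>"
        using \<delta>2(2)[of s] \<delta>3(2)[of s] s
        by (auto simp: dist_norm norm_minus_commute[of "x t"] less_imp_le)
      ultimately show ?thesis by (intro add_left_mono mult_left_mono add_mono)
    qed
    also have "\<dots> \<le> ?D + \<eta> * \<bar>B\<bar> + 2 * (sqrt hi * \<kappa>)"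
    proof -
      have "\<eta> * ?D \<le> \<eta> * \<bar>B\<bar>" using Ds \<eta>(1) by (intro mult_left_mono) auto
      then show ?thesis by (simp add: algebra_simps)
    qed
    also have "\<dots> \<le> ?D + e" using \<eta>(2) \<kappa>(2) by linarith
    finally show ?thesis .
  qed
  then show ?thesis
    using \<delta>1(1) \<delta>2(1) \<delta>3(1) by (intro exI[of _ "min \<delta>1 (min \<delta>2 \<delta>3)"]) auto
qed

text \<open>Here \<open>f\<close> is the field frozen at the single time t: \<open>xd\<close> and
  \<open>x\<close> are differentiated only there, and the drift of the metric is accounted for by
  the component 1 in \<open>DM (y, t) (f y, 1)\<close>.\<close>

lemma geo_dist_flow_step:
  assumes f: "\<And>y. (f has_derivative Df y) (at y)"
    and Df: "\<And>v. continuous_on UNIV (\<lambda>y. Df y v)"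
    and t: "t \<ge> 0" and \<alpha>: "\<alpha> > 0" and e: "e > 0"
    and contr: "\<And>y v. v \<bullet> (DM (y, t) (f y, 1) *v v) + 2 * (v \<bullet> (M y t *v Df y v))
      \<le> - 2 * \<alpha> * (v \<bullet> (M y t *v v))"
    and xd: "(xd has_vector_derivative f (xd t)) (at t within {0..})"
    and x: "(x has_vector_derivative f (x t) + g) (at t within {0..})"
  shows "\<exists>\<delta>>0. \<forall>s. 0 < s \<and> s < \<delta> \<longrightarrow> geo_dist (speed M (t + s)) (xd (t + s)) (x (t + s))
    \<le> geo_dist (speed M t) (xd t) (x t)
      + s * (sqrt hi * norm g - \<alpha> * geo_dist (speed M t) (xd t) (x t) + e)"
proof -
  interpret Ft: finsler "speed M t" "sqrt lo" "sqrt hi" using t by (rule finsler_speed)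
  have hi: "0 < sqrt hi" using hi_pos by simp
  define D where "D = geo_dist (speed M t) (xd t) (x t)"
  have D: "D \<ge> 0" unfolding D_def by (rule Ft.geo_dist_nonneg)
  \<comment> \<open>The speed factor contributes \<eta> s D and each endpoint \<eta> s sqrt hi; this
    choice makes the total equal to s e.\<close>
  define \<eta> where "\<eta> = e / (D + 2 * sqrt hi)"
  have "D + 2 * sqrt hi > 0" using D hi by linarith
  then have \<eta>: "\<eta> > 0" "\<eta> * (D + 2 * sqrt hi) = e"
    using e unfolding \<eta>_def by simp_all
  define r where "r = (D + 1) / sqrt lo"
  obtain \<delta>1 where \<delta>1: "\<delta>1 > 0" "\<And>s y v. s \<in> {0..\<delta>1} \<Longrightarrow> y \<in> cball (xd t) r \<Longrightarrow>
      speed M (t + s) (y + s *\<^sub>R f y) (v + s *\<^sub>R Df y v) \<le> (1 - \<alpha> * s + \<eta> * s) * speed M t y v"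
    using speed_flow_step[OF f Df t \<alpha> \<eta>(1) compact_cball contr, of "xd t" r] by blast
  obtain \<delta>2 where \<delta>2: "\<delta>2 > 0"
    "\<And>s. 0 < s \<Longrightarrow> s < \<delta>2 \<Longrightarrow> norm (xd (t + s) - xd t - s *\<^sub>R f (xd t)) \<le> \<eta> * s"
    using right_derivative_bound[OF xd t \<eta>(1)] by blast
  obtain \<delta>3 where \<delta>3: "\<delta>3 > 0"
    "\<And>s. 0 < s \<Longrightarrow> s < \<delta>3 \<Longrightarrow> norm (x (t + s) - x t - s *\<^sub>R (f (x t) + g)) \<le> \<eta> * s"
    using right_derivative_bound[OF x t \<eta>(1)] by blast
  define \<delta> where "\<delta> = min (min \<delta>1 (1 / \<alpha>)) (min \<delta>2 \<delta>3)"
  have "geo_dist (speed M (t + s)) (xd (t + s)) (x (t + s)) \<le> D + s * (sqrt hi * norm g - \<alpha> * D + e)"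
    if s: "0 < s" "s < \<delta>" for s
  proof -
    have c: "0 \<le> 1 - \<alpha> * s + \<eta> * s"
    proof -
      have "\<alpha> * s \<le> 1" using s \<alpha> by (simp add: \<delta>_def field_simps)
      moreover have "0 \<le> \<eta> * s" using s \<eta> by simp
      ultimately show ?thesis by linarith
    qed
    have N': "finsler (speed M (t + s)) (sqrt lo) (sqrt hi)" using s t by (intro finsler_speed) simp
    have "geo_dist (speed M (t + s)) (xd (t + s)) (x (t + s))
      \<le> (1 - \<alpha> * s + \<eta> * s) * geo_dist (speed M t) (xd t) (x t)
        + sqrt hi * (norm (xd t + s *\<^sub>R f (xd t) - xd (t + s)) + norm (x (t + s) - (x t + s *\<^sub>R f (x t))))"
    proof (rule Ft.geo_dist_map_le[where \<phi> = "\<lambda>y. y + s *\<^sub>R f y" and \<phi>' = "\<lambda>y v. v + s *\<^sub>R Df y v"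
          and z = "xd t" and r = r, OF N' _ _ _ c])
      show "((\<lambda>y. y + s *\<^sub>R f y) has_derivative (\<lambda>v. v + s *\<^sub>R Df y v)) (at y)" for y
        by (intro derivative_intros f)
      have "continuous_on UNIV (\<lambda>z::(real^'n) \<times> (real^'n). Df (fst z) (snd z))"
      proof (rule continuous_on_linear_family[where L = "\<lambda>z. Df (fst z)"])
        show "linear (Df (fst z))" for z :: "(real^'n) \<times> (real^'n)" using f by (rule has_derivative_linear)
        show "continuous_on UNIV (\<lambda>z::(real^'n) \<times> (real^'n). Df (fst z) v)" for v
          by (rule continuous_on_compose2[OF Df]) (auto intro!: continuous_intros)
      qed (intro continuous_intros)
      then show "continuous_on UNIV (\<lambda>(y, v). v + s *\<^sub>R Df y v)"
        unfolding case_prod_beta by (intro continuous_intros)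
      show "speed M (t + s) (y + s *\<^sub>R f y) (v + s *\<^sub>R Df y v) \<le> (1 - \<alpha> * s + \<eta> * s) * speed M t y v"
        if "y \<in> cball (xd t) r" for y v
        using s that by (intro \<delta>1(2)) (auto simp: \<delta>_def)
    qed (simp add: r_def D_def)
    also have "\<dots> \<le> (1 - \<alpha> * s + \<eta> * s) * D + sqrt hi * (\<eta> * s + (\<eta> * s + s * norm g))"
    proof -
      have "norm (xd t + s *\<^sub>R f (xd t) - xd (t + s)) \<le> \<eta> * s"
        using \<delta>2(2)[of s] s norm_minus_commute[of "xd t + s *\<^sub>R f (xd t)" "xd (t + s)"]
        by (simp add: \<delta>_def algebra_simps)
      moreover have "norm (x (t + s) - (x t + s *\<^sub>R f (x t))) \<le> \<eta> * s + s * norm g"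
      proof -
        have "x (t + s) - (x t + s *\<^sub>R f (x t)) = (x (t + s) - x t - s *\<^sub>R (f (x t) + g)) + s *\<^sub>R g"
          by (simp add: algebra_simps)
        also have "norm \<dots> \<le> norm (x (t + s) - x t - s *\<^sub>R (f (x t) + g)) + norm (s *\<^sub>R g)"
          by (rule norm_triangle_ineq)
        also have "\<dots> \<le> \<eta> * s + s * norm g"
          using \<delta>3(2)[of s] s by (simp add: \<delta>_def)
        finally show ?thesis .
      qed
      ultimately show ?thesis
        unfolding D_def using hi by (intro add_left_mono mult_left_mono add_mono) auto
    qed
    also have "\<dots> = D + s * (sqrt hi * norm g - \<alpha> * D + \<eta> * (D + 2 * sqrt hi))"
      by (simp add: algebra_simps)
    finally show ?thesis unfolding \<eta>(2) .
  qed
  moreover have "\<delta> > 0" using \<delta>1(1) \<delta>2(1) \<delta>3(1) \<alpha> by (simp add: \<delta>_def)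
  ultimately show ?thesis unfolding D_def by blast
qed

end

text \<open>The part of \<open>g\<close> that grows with the separation is traded against the decay:
  c1 |x - xd| \<le> c1 D / sqrt lo, which costs sqrt hi times as much in the metric and lowers
  \<alpha> to a.\<close>

lemma (in time_metric) endpoint_distance_bound:
  fixes f :: "real \<Rightarrow> real^'n \<Rightarrow> real^'n"
  assumes f: "\<And>t y. 0 \<le> t \<Longrightarrow> (f t has_derivative Df t y) (at y)"
    and Df: "\<And>t v. 0 \<le> t \<Longrightarrow> continuous_on UNIV (\<lambda>y. Df t y v)"
    and \<alpha>: "\<alpha> > 0"
    and contr: "\<And>t y v. 0 \<le> t \<Longrightarrow>
      v \<bullet> (DM (y, t) (f t y, 1) *v v) + 2 * (v \<bullet> (M y t *v Df t y v)) \<le> - 2 * \<alpha> * (v \<bullet> (M y t *v v))"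
    and xd: "\<And>t. 0 \<le> t \<Longrightarrow> (xd has_vector_derivative f t (xd t)) (at t within {0..})"
    and x: "\<And>t. 0 \<le> t \<Longrightarrow> (x has_vector_derivative f t (x t) + g t) (at t within {0..})"
    and T: "0 \<le> T"
    and g: "\<And>t. 0 \<le> t \<Longrightarrow> t < T \<Longrightarrow> norm (g t) \<le> c0 + c1 * norm (x t - xd t)"
    and c1: "0 \<le> c1"
    and rate: "a = \<alpha> - c1 * (sqrt hi / sqrt lo)" "a > 0"
  shows "norm (x T - xd T) \<le> geo_dist (speed M 0) (xd 0) (x 0) / sqrt lo * exp (- a * T)
    + c0 / a * (sqrt hi / sqrt lo) * (1 - exp (- a * T))"
proof -
  define D where "D = (\<lambda>t. geo_dist (speed M t) (xd t) (x t))"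
  have lo: "0 < sqrt lo" and hi: "0 < sqrt hi" using lo_pos hi_pos by auto
  have D_lower: "norm (x t - xd t) \<le> D t / sqrt lo" if "0 \<le> t" for t
  proof -
    interpret finsler "speed M t" "sqrt lo" "sqrt hi" using that by (rule finsler_speed)
    show ?thesis using geo_dist_lower[of "x t" "xd t"] lo by (simp add: D_def field_simps)
  qed
  have cont: "continuous_on {0..t} xd" "continuous_on {0..t} x" for t
  proof -
    have "continuous_on {0..} xd" "continuous_on {0..} x"
      using xd x by (auto simp: continuous_on_eq_continuous_within intro: has_vector_derivative_continuous)
    then show "continuous_on {0..t} xd" "continuous_on {0..t} x"
      by (auto elim: continuous_on_subset)
  qed
  have "D T \<le> exp (- a * T) * D 0 + (sqrt hi * c0) / a * (1 - exp (- a * T))"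
  proof (rule dini_comparison[OF rate(2) T])
    fix t e :: real assume t: "0 \<le> t" "t < T" and e: "e > 0"
    have "sqrt hi * norm (g t) - \<alpha> * D t \<le> sqrt hi * c0 - a * D t"
    proof -
      have "norm (g t) \<le> c0 + c1 * (D t / sqrt lo)"
        using g[OF t] mult_left_mono[OF D_lower[OF t(1)] c1] by linarith
      then have "sqrt hi * norm (g t) \<le> sqrt hi * (c0 + c1 * (D t / sqrt lo))"
        using hi by (intro mult_left_mono) auto
      then show ?thesis by (simp add: rate(1) algebra_simps)
    qed
    then have *: "s * (sqrt hi * norm (g t) - \<alpha> * D t + e) \<le> s * (sqrt hi * c0 - a * D t + e)"
      if "0 < s" for s using that by (intro mult_left_mono) auto
    obtain \<delta> where \<delta>: "\<delta> > 0"
      "\<And>s. 0 < s \<Longrightarrow> s < \<delta> \<Longrightarrow> D (t + s) \<le> D t + s * (sqrt hi * norm (g t) - \<alpha> * D t + e)"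
      using geo_dist_flow_step[OF f[OF t(1)] Df[OF t(1)] t(1) \<alpha> e contr[OF t(1)] xd[OF t(1)] x[OF t(1)]]
      unfolding D_def by blast
    have "D (t + s) \<le> D t + s * (sqrt hi * c0 - a * D t + e)" if "0 < s" "s < \<delta>" for s
      using \<delta>(2)[OF that] *[OF that(1)] by linarith
    then show "\<exists>\<delta>>0. \<forall>s. 0 < s \<and> s < \<delta> \<longrightarrow> D (t + s) \<le> D t + s * (sqrt hi * c0 - a * D t + e)"
      using \<delta>(1) by blast
  next
    fix t e B :: real assume "0 < t" "t \<le> T" "e > 0"
    then show "\<exists>\<delta>>0. \<forall>s. 0 \<le> s \<and> t - \<delta> < s \<and> s < t \<and> D s \<le> B \<longrightarrow> D t \<le> D s + e"
      unfolding D_def using geo_dist_left_semicontinuous[OF _ _ cont] by blast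
  qed
  then have "D T / sqrt lo \<le> (exp (- a * T) * D 0 + (sqrt hi * c0) / a * (1 - exp (- a * T))) / sqrt lo"
    using lo by (intro divide_right_mono) auto
  also have "\<dots> = D 0 / sqrt lo * exp (- a * T) + c0 / a * (sqrt hi / sqrt lo) * (1 - exp (- a * T))"
    by (simp add: add_divide_distrib mult_ac)
  finally show ?thesis
    using D_lower[OF T] unfolding D_def by linarith
qed

section \<open>The closed-loop system\<close>

lemma (in finsler) geo_dist_le_path_integral:
  assumes "\<And>\<sigma>. \<sigma> \<in> {0..1} \<Longrightarrow> (\<gamma> has_vector_derivative \<gamma>' \<sigma>) (at \<sigma> within {0..1})"
    and "continuous_on {0..1} \<gamma>'"
  shows "geo_dist N (\<gamma> 0) (\<gamma> 1) \<le> integral {0..1} (\<lambda>\<sigma>. N (\<gamma> \<sigma>) (\<gamma>' \<sigma>))"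
  by (rule geo_dist_le, rule joined.C1_path[OF assms order_refl])

section \<open>Smoothness, segments, quadratic forms and derivatives in the given encoding\<close>

lemma Ck_on_1_E:
  assumes "Ck_on 1 f S"
  obtains f' where "\<And>x. x \<in> S \<Longrightarrow> (f has_derivative f' x) (at x within S)"
    "\<And>v. continuous_on S (\<lambda>x. f' x v)"
  using assms by (auto simp: One_nat_def)

text \<open>The zero function is its own derivative, so induction closes here; for other constants
  one differentiation leads to this case.\<close>

lemma Ck_on_0_const [simp]: "Ck_on k (\<lambda>_. 0) S"
  by (induction k) (auto intro!: exI[of _ "\<lambda>_ _. 0"])

lemma Ck_on_const [simp]: "Ck_on k (\<lambda>_. c) S"
  by (cases k) (auto intro!: exI[of _ "\<lambda>_ _. 0"])

text \<open>Every directional derivative is constant, so all orders follow. This makes the segment,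
  with the least possible length, an admissible path in A1.\<close>

lemma smooth_path_segment: "smooth_path (\<lambda>\<sigma>. a + \<sigma> *\<^sub>R (b - a)) a b"
proof -
  have "Ck_on k (\<lambda>\<sigma>. a + \<sigma> *\<^sub>R (b - a)) {0..1}" for k
  proof (cases k)
    case (Suc j)
    have "\<forall>\<sigma>\<in>{0..1}. ((\<lambda>\<sigma>. a + \<sigma> *\<^sub>R (b - a)) has_derivative (\<lambda>v. v *\<^sub>R (b - a))) (at \<sigma> within {0..1})"
      by (auto intro!: derivative_eq_intros)
    then show ?thesis unfolding Suc Ck_on.simps by (intro exI[of _ "\<lambda>_ v. v *\<^sub>R (b - a)"]) simp
  qed (auto intro!: continuous_intros)
  then show ?thesis by (simp add: smooth_path_def smooth_on_def)
qed

lemma path_len_segment: "path_len (\<lambda>\<sigma>. a + \<sigma> *\<^sub>R (b - a)) = norm (b - a)"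
proof -
  have "vector_derivative (\<lambda>\<sigma>. a + \<sigma> *\<^sub>R (b - a)) (at \<sigma> within {0..1}) = b - a" if "\<sigma> \<in> {0..1}" for \<sigma>
    using that by (intro vector_derivative_within_closed_interval) (auto intro!: derivative_eq_intros)
  then have "path_len (\<lambda>\<sigma>. a + \<sigma> *\<^sub>R (b - a)) = integral {0..1::real} (\<lambda>_. norm (b - a))"
    unfolding path_len_def by (intro integral_cong) simp
  then show ?thesis by simp
qed

lemma quadratic_form_gram:
  fixes A :: "real^'n^'m"
  shows "v \<bullet> ((transpose A ** A) *v v) = (norm (A *v v))\<^sup>2"
  unfolding power2_norm_eq_inner matrix_vector_mul_assoc[symmetric]
  by (subst inner_commute) (simp add: dot_lmul_matrix)

lemma quadratic_form_sym_part: "v \<bullet> (sym_part A *v v) = v \<bullet> (A *v v)"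
proof -
  have "v \<bullet> (transpose A *v v) = v \<bullet> (A *v v)"
    by (subst inner_commute) (simp add: dot_lmul_matrix)
  then show ?thesis
    by (simp add: sym_part_def scaleR_matrix_vector_assoc[symmetric] matrix_vector_mult_add_rdistrib
        inner_add_right)
qed

lemma loewner_leD: "A \<preceq> B \<Longrightarrow> v \<bullet> (A *v v) \<le> v \<bullet> (B *v v)"
  by (force simp: loewner_le_def pos_semidef_def matrix_vector_mult_diff_rdistrib inner_diff_right)

lemma quadratic_form_scaled_identity: "v \<bullet> ((c *\<^sub>R mat 1) *v v) = c * (norm v)\<^sup>2"
  for v :: "real^'n"
  by (simp add: scaleR_matrix_vector_assoc[symmetric] power2_norm_eq_inner)

text \<open>The partial derivatives in \<open>metric_rate\<close> are restrictions of L to the time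
  slice and the space slice through (x, t); linearity reassembles them.\<close>

lemma metric_rate_eq:
  fixes M :: "real^'n \<Rightarrow> real \<Rightarrow> real^'n^'n"
  assumes D: "((\<lambda>(y, t). M y t) has_derivative L) (at (x, t) within UNIV \<times> {0..})" and t: "t \<ge> 0"
  shows "metric_rate M f x t = L (f, 1)"
proof -
  have lin: "linear L" using D by (rule has_derivative_linear)
  have "((\<lambda>s. (x, s)) has_derivative (\<lambda>h. (0, h))) (at t within {0..})"
    by (auto intro!: derivative_eq_intros)
  moreover have "((\<lambda>(y, t). M y t) has_derivative L) (at (x, t) within (\<lambda>s. (x, s)) ` {0..})"
    by (rule has_derivative_subset[OF D]) auto
  ultimately have "((\<lambda>s. (\<lambda>(y, t). M y t) (x, s)) has_derivative (\<lambda>h. L (0, h))) (at t within {0..})"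
    by (rule has_derivative_in_compose)
  moreover have eq: "(\<lambda>h. h *\<^sub>R L (0, 1)) = (\<lambda>h. L (0, h))"
  proof
    show "h *\<^sub>R L (0, 1) = L (0, h)" for h
      using linear_cmul[OF lin, of h "(0, 1)"] by simp
  qed
  ultimately have "((\<lambda>s. M x s) has_vector_derivative L (0, 1)) (at t within {0..})"
    unfolding has_vector_derivative_def eq by simp
  \<comment> \<open>The one-sided filter must be nontrivial for \<open>vector_derivative\<close> to
    be determined.\<close>
  moreover have "at t within {0..} \<noteq> bot"
  proof -
    have "t islimpt {t..t+1}" by (simp add: islimpt_Icc)
    then have "t islimpt {0..}" by (rule islimpt_subset) (use t in auto)
    then show ?thesis by (simp add: trivial_limit_within)
  qed
  ultimately have 1: "vector_derivative (\<lambda>s. M x s) (at t within {0..}) = L (0, 1)"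
    by (intro vector_derivative_within)
  have "((\<lambda>y. (y, t)) has_derivative (\<lambda>v. (v, 0))) (at x)"
    by (auto intro!: derivative_eq_intros)
  moreover have "((\<lambda>(y, t). M y t) has_derivative L) (at (x, t) within (\<lambda>y. (y, t)) ` UNIV)"
    by (rule has_derivative_subset[OF D]) (use t in auto)
  ultimately have "((\<lambda>y. (\<lambda>(y, t). M y t) (y, t)) has_derivative (\<lambda>v. L (v, 0))) (at x)"
    by (rule has_derivative_in_compose)
  then have "((\<lambda>y. M y t) has_derivative (\<lambda>v. L (v, 0))) (at x)" by simp
  then have 2: "frechet_derivative (\<lambda>y. M y t) (at x) = (\<lambda>v. L (v, 0))"
    by (rule frechet_derivative_at[symmetric])
  have lin': "linear (\<lambda>v. L (v, 0))"
  proof -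
    have "linear (\<lambda>v::real^'n. (v, 0::real))" by (simp add: linear_iff)
    from linear_compose[OF this lin] show ?thesis by (simp add: o_def)
  qed
  have "(\<Sum>i\<in>UNIV. (f $ i) *\<^sub>R L (axis i 1, 0)) = L (\<Sum>i\<in>UNIV. (f $ i) *\<^sub>R axis i 1, 0)"
    by (simp only: linear_sum[OF lin'] linear_cmul[OF lin'])
  also have "(\<Sum>i\<in>UNIV. (f $ i) *\<^sub>R axis i 1) = f"
    using basis_expansion[of f] by (simp add: scalar_mult_eq_scaleR)
  finally show ?thesis
    unfolding metric_rate_def 1 2 using linear_add[OF lin, of "(0, 1)" "(f, 0)"] by simp
qed

text \<open>Chain rule along y \<mapsto> (y, k y, t). Time is constant there, hence the component 0,
  and the restriction of \<open>h\<close> to nonnegative times still yields a full derivative in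
  y.\<close>

lemma closed_loop_C1:
  fixes h :: "real^'n \<Rightarrow> real^'m \<Rightarrow> real \<Rightarrow> real^'k"
  assumes h: "Ck_on 1 (\<lambda>(x, u, t). h x u t) (UNIV \<times> UNIV \<times> {0..})"
    and k: "Ck_on 1 k UNIV" and t: "t \<ge> 0"
  obtains Df where "\<And>y. ((\<lambda>y. h y (k y) t) has_derivative Df y) (at y)"
    "\<And>v. continuous_on UNIV (\<lambda>y. Df y v)"
proof -
  obtain Dh where Dh: "\<And>p. p \<in> UNIV \<times> UNIV \<times> {0..} \<Longrightarrow>
      ((\<lambda>(x, u, t). h x u t) has_derivative Dh p) (at p within UNIV \<times> UNIV \<times> {0..})"
    "\<And>w. continuous_on (UNIV \<times> UNIV \<times> {0..}) (\<lambda>p. Dh p w)"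
    using h by (rule Ck_on_1_E) blast
  obtain Dk where Dk: "\<And>y. (k has_derivative Dk y) (at y)" "\<And>v. continuous_on UNIV (\<lambda>y. Dk y v)"
    using k by (rule Ck_on_1_E) blast
  have k_cont: "continuous_on UNIV k"
    using Dk(1) by (meson continuous_at_imp_continuous_on has_derivative_continuous)
  show thesis
  proof (rule that[where Df = "\<lambda>y v. Dh (y, k y, t) (v, Dk y v, 0)"])
    fix y
    have 1: "((\<lambda>y. (y, k y, t)) has_derivative (\<lambda>v. (v, Dk y v, 0))) (at y)"
      by (intro has_derivative_Pair has_derivative_ident Dk(1) has_derivative_const)
    have "((\<lambda>y. (\<lambda>(x, u, t). h x u t) (y, k y, t)) has_derivative
        (\<lambda>v. Dh (y, k y, t) (v, Dk y v, 0))) (at y)"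
      by (rule has_derivative_in_compose2[OF Dh(1) _ _ 1]) (use t in auto)
    then show "((\<lambda>y. h y (k y) t) has_derivative (\<lambda>v. Dh (y, k y, t) (v, Dk y v, 0))) (at y)"
      by simp
  next
    fix v
    show "continuous_on UNIV (\<lambda>y. Dh (y, k y, t) (v, Dk y v, 0))"
    proof (rule continuous_on_linear_family[where L = "\<lambda>y. Dh (y, k y, t)"])
      show "linear (Dh (y, k y, t))" for y
        using Dh(1)[of "(y, k y, t)"] t by (intro has_derivative_linear) auto
      show "continuous_on UNIV (\<lambda>y. Dh (y, k y, t) w)" for w
        by (rule continuous_on_compose2[OF Dh(2)]) (use t in \<open>auto intro!: continuous_intros k_cont\<close>)
      show "continuous_on UNIV (\<lambda>y. (v, Dk y v, 0::real))"
        by (intro continuous_intros Dk(2))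
    qed
  qed
qed

text \<open>The bound at t accumulates the perturbation over all earlier times, and A1 and A2
  control it only inside the given sets; hence the premise on the whole of [0, t].\<close>

theorem theorem2:
  fixes h :: "real^'n \<Rightarrow> real^'m \<Rightarrow> real \<Rightarrow> real^'n"
    and d :: "real^'n \<Rightarrow> real \<Rightarrow> real^'n"
    and ustar uL :: "real^'n \<Rightarrow> real^'n \<Rightarrow> real^'m \<Rightarrow> real \<Rightarrow> real^'m"
    and M \<Theta> :: "real^'n \<Rightarrow> real \<Rightarrow> real^'n^'n"
    and x xd :: "real \<Rightarrow> real^'n"
    and ud :: "real \<Rightarrow> real^'m"
    and q :: "real \<Rightarrow> real \<Rightarrow> real^'n"
    and Sx :: "(real^'n) set" and Su :: "(real^'m) set" and St :: "real set"
    and dbar \<epsilon>0 \<epsilon>1 Lu \<alpha> \<alpha>l m_lo m_hi :: real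
  assumes h_smooth: "smooth_on (\<lambda>(x, u, t). h x u t) (UNIV \<times> UNIV \<times> {0..})"
    and d_bounded: "bdd_above ((\<lambda>(x, t). norm (d x t)) ` (UNIV \<times> {0..}))"
    and dbar: "dbar = (SUP (x, t)\<in>UNIV \<times> {0..}. norm (d x t))"
    and ustar_C1: "\<And>xd ud t. t \<ge> 0 \<Longrightarrow> Ck_on 1 (\<lambda>x. ustar x xd ud t) UNIV"
    and M_C1: "Ck_on 1 (\<lambda>(x, t). M x t) (UNIV \<times> {0..})"
    and M_Theta: "\<And>x t. t \<ge> 0 \<Longrightarrow> M x t = transpose (\<Theta> x t) ** \<Theta> x t"
    and alpha: "\<alpha> > 0"
    and contraction: "\<And>x t. t \<ge> 0 \<Longrightarrow>
      metric_rate M (h x (ustar x (xd t) (ud t) t) t) x t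
      + 2 *\<^sub>R sym_part (M x t ** jacobian (\<lambda>y. h y (ustar y (xd t) (ud t) t) t) (at x))
      + (2 * \<alpha>) *\<^sub>R M x t \<preceq> 0"
    and m_lo: "m_lo > 0" and m_hi: "m_hi > 0"
    and M_bounds: "\<And>x t. t \<ge> 0 \<Longrightarrow> m_lo *\<^sub>R mat 1 \<preceq> M x t \<and> M x t \<preceq> m_hi *\<^sub>R mat 1"
    and ud: "\<And>t. t \<ge> 0 \<Longrightarrow> ud t = ustar (xd t) (xd t) (ud t) t"
    and xd: "\<And>t. t \<ge> 0 \<Longrightarrow> (xd has_vector_derivative h (xd t) (ud t) t) (at t within {0..})"
    and x: "\<And>t. t \<ge> 0 \<Longrightarrow>
      (x has_vector_derivative h (x t) (uL (x t) (xd t) (ud t) t) t + d (x t) t) (at t within {0..})"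
    and q_path: "\<And>t. t \<ge> 0 \<Longrightarrow> smooth_path (\<lambda>\<mu>. q \<mu> t) (xd t) (x t)"
    and q_virtual: "\<And>\<mu> t. \<mu> \<in> {0..1} \<Longrightarrow> t \<ge> 0 \<Longrightarrow>
      ((\<lambda>s. q \<mu> s) has_vector_derivative
         h (q \<mu> t) (ustar (q \<mu> t) (xd t) (ud t) t) t
         + \<mu> *\<^sub>R (h (x t) (uL (x t) (xd t) (ud t) t) t
                 - h (x t) (ustar (x t) (xd t) (ud t) t) t + d (x t) t)) (at t within {0..})"
    and compact_sets: "compact Sx" "compact Su" "compact St" "St \<subseteq> {0..}"
    and eps: "\<epsilon>0 \<ge> 0" "\<epsilon>1 \<ge> 0"
    and A1: "\<And>y yd v t \<gamma>. y \<in> Sx \<Longrightarrow> yd \<in> Sx \<Longrightarrow> v \<in> Su \<Longrightarrow> t \<in> St \<Longrightarrow> smooth_path \<gamma> yd y \<Longrightarrow>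
      norm (uL y yd v t - ustar y yd v t) \<le> \<epsilon>0 + \<epsilon>1 * path_len \<gamma>"
    and Lu: "Lu \<ge> 0"
    and A2: "\<And>y u u' t. y \<in> Sx \<Longrightarrow> t \<in> St \<Longrightarrow> norm (h y u t - h y u' t) \<le> Lu * norm (u - u')"
    and alphal: "\<alpha>l = \<alpha> - Lu * \<epsilon>1 * sqrt (m_hi / m_lo)"
    and alphal_pos: "\<alpha>l > 0"
  shows "\<forall>t\<ge>0. (\<forall>s\<in>{0..t}. (x s, xd s, ud s, s) \<in> Sx \<times> Sx \<times> Su \<times> St) \<longrightarrow>
    norm (x t - xd t)
      \<le> norm (weighted_path_len (\<lambda>y. \<Theta> y 0) (\<lambda>\<mu>. q \<mu> 0)) / sqrt m_lo * exp (- \<alpha>l * t)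
        + (Lu * \<epsilon>0 + dbar) / \<alpha>l * sqrt (m_hi / m_lo) * (1 - exp (- \<alpha>l * t))"
proof (intro allI impI)
  fix T :: real
  assume T: "0 \<le> T" and dom: "\<forall>s\<in>{0..T}. (x s, xd s, ud s, s) \<in> Sx \<times> Sx \<times> Su \<times> St"
  define f where "f = (\<lambda>t y. h y (ustar y (xd t) (ud t) t) t)"
  \<comment> \<open>This is the perturbation d_q of the virtual system at \<mu> = 1, that is, at q =
    x.\<close>
  define g where "g = (\<lambda>t. h (x t) (uL (x t) (xd t) (ud t) t) t
    - h (x t) (ustar (x t) (xd t) (ud t) t) t + d (x t) t)"
  \<comment> \<open>The condition on t stands under the quantifier so that \<open>choice\<close>
    yields one function of all real t.\<close>
  have "\<exists>Df. 0 \<le> t \<longrightarrow> (\<forall>y. (f t has_derivative Df y) (at y)) \<and> (\<forall>v. continuous_on UNIV (\<lambda>y. Df y v))" for t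
  proof (cases "0 \<le> t")
    case True
    have "Ck_on 1 (\<lambda>(x, u, t). h x u t) (UNIV \<times> UNIV \<times> {0..})"
      using h_smooth unfolding smooth_on_def by blast
    then show ?thesis
    proof (rule closed_loop_C1)
      show "Ck_on 1 (\<lambda>y. ustar y (xd t) (ud t) t) UNIV" using True by (rule ustar_C1)
    qed (use True in \<open>unfold f_def, blast+\<close>)
  qed simp
  then have "\<forall>t. \<exists>Df. 0 \<le> t \<longrightarrow> (\<forall>y. (f t has_derivative Df y) (at y)) \<and> (\<forall>v. continuous_on UNIV (\<lambda>y. Df y v))"
    by blast
  from choice[OF this]
  obtain Df where Df: "\<And>t y. 0 \<le> t \<Longrightarrow> (f t has_derivative Df t y) (at y)"
      "\<And>t v. 0 \<le> t \<Longrightarrow> continuous_on UNIV (\<lambda>y. Df t y v)"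
    by blast
  obtain DM where DM: "\<And>p. p \<in> UNIV \<times> {0..} \<Longrightarrow>
      ((\<lambda>(y, t). M y t) has_derivative DM p) (at p within UNIV \<times> {0..})"
    "\<And>w. continuous_on (UNIV \<times> {0..}) (\<lambda>p. DM p w)"
    using M_C1 by (rule Ck_on_1_E) blast
  interpret time_metric M DM m_lo m_hi
  proof
    show "transpose (M y t) = M y t" if "t \<ge> 0" for t y
      using that by (simp add: M_Theta matrix_transpose_mul)
    show "m_lo * (norm v)\<^sup>2 \<le> v \<bullet> (M y t *v v)" "v \<bullet> (M y t *v v) \<le> m_hi * (norm v)\<^sup>2" if "t \<ge> 0" for t y v
      using loewner_leD[of "m_lo *\<^sub>R mat 1" "M y t" v] loewner_leD[of "M y t" "m_hi *\<^sub>R mat 1" v]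
        M_bounds[OF that, of y] by (auto simp: quadratic_form_scaled_identity)
  qed (use DM m_lo in auto)
  have contr: "v \<bullet> (DM (y, t) (f t y, 1) *v v) + 2 * (v \<bullet> (M y t *v Df t y v))
      \<le> - 2 * \<alpha> * (v \<bullet> (M y t *v v))" if t: "0 \<le> t" for t y v
  proof -
    \<comment> \<open>Uniqueness of the derivative identifies the \<open>jacobian\<close> of the
      contraction condition with \<open>Df\<close>.\<close>
    have "Df t y = frechet_derivative (f t) (at y)"
      using Df(1)[OF t] by (rule frechet_derivative_at)
    then have J: "jacobian (f t) (at y) *v v = Df t y v"
      using has_derivative_linear[OF Df(1)[OF t, of y]] by (simp add: jacobian_def matrix_works)
    have R: "metric_rate M (f t y) y t = DM (y, t) (f t y, 1)"
      using t by (intro metric_rate_eq DM) auto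
    have "metric_rate M (f t y) y t + 2 *\<^sub>R sym_part (M y t ** jacobian (f t) (at y)) + (2 * \<alpha>) *\<^sub>R M y t \<preceq> 0"
      using contraction[OF t, of y] by (simp add: f_def)
    from loewner_leD[OF this, of v] show ?thesis
      by (simp add: R J matrix_vector_mult_add_rdistrib inner_add_right quadratic_form_sym_part
          scaleR_matrix_vector_assoc[symmetric] matrix_vector_mul_assoc[symmetric])
  qed
  have g_bound: "norm (g t) \<le> (Lu * \<epsilon>0 + dbar) + Lu * \<epsilon>1 * norm (x t - xd t)" if t: "0 \<le> t" "t < T" for t
  proof -
    have in_S: "x t \<in> Sx" "xd t \<in> Sx" "ud t \<in> Su" "t \<in> St" using dom t by auto
    have "norm (uL (x t) (xd t) (ud t) t - ustar (x t) (xd t) (ud t) t) \<le> \<epsilon>0 + \<epsilon>1 * norm (x t - xd t)"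
      using A1[OF in_S smooth_path_segment] by (simp add: path_len_segment)
    from mult_left_mono[OF this Lu] A2[OF in_S(1,4)]
    have "norm (h (x t) (uL (x t) (xd t) (ud t) t) t - h (x t) (ustar (x t) (xd t) (ud t) t) t)
        \<le> Lu * (\<epsilon>0 + \<epsilon>1 * norm (x t - xd t))"
      by (rule order_trans[rotated])
    moreover have "norm (d (x t) t) \<le> dbar"
      unfolding dbar using cSUP_upper[OF _ d_bounded, of "(x t, t)"] t by simp
    ultimately show ?thesis
      unfolding g_def by (intro norm_triangle_le) (simp add: algebra_simps)
  qed
  have "norm (x T - xd T) \<le> geo_dist (speed M 0) (xd 0) (x 0) / sqrt m_lo * exp (- \<alpha>l * T)
    + (Lu * \<epsilon>0 + dbar) / \<alpha>l * (sqrt m_hi / sqrt m_lo) * (1 - exp (- \<alpha>l * T))"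
  proof (rule endpoint_distance_bound[OF Df alpha contr _ _ T g_bound _ _ alphal_pos])
    \<comment> \<open>The fixed-point equation for \<open>ud\<close> makes the target an unperturbed
      trajectory of f.\<close>
    show "(xd has_vector_derivative f t (xd t)) (at t within {0..})" if "0 \<le> t" for t
      using xd[OF that] ud[OF that] by (simp add: f_def)
    show "(x has_vector_derivative f t (x t) + g t) (at t within {0..})" if "0 \<le> t" for t
      using x[OF that] by (simp add: f_def g_def)
  qed (use Lu eps in \<open>auto simp: alphal real_sqrt_divide\<close>)
  moreover have "geo_dist (speed M 0) (xd 0) (x 0)
      \<le> weighted_path_len (\<lambda>y. \<Theta> y 0) (\<lambda>\<mu>. q \<mu> 0)"
  proof -
    interpret F: finsler "speed M 0" "sqrt m_lo" "sqrt m_hi" by (rule finsler_speed) simp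
    have q: "Ck_on 1 (\<lambda>\<mu>. q \<mu> 0) {0..1}" "q 0 0 = xd 0" "q 1 0 = x 0"
      using q_path[of 0] by (auto simp: smooth_path_def smooth_on_def)
    obtain q' where q': "\<And>\<mu>. \<mu> \<in> {0..1} \<Longrightarrow> ((\<lambda>\<mu>. q \<mu> 0) has_derivative q' \<mu>) (at \<mu> within {0..1})"
      "\<And>v. continuous_on {0..1} (\<lambda>\<mu>. q' \<mu> v)"
      using q(1) by (rule Ck_on_1_E) blast
    \<comment> \<open>\<open>Ck_on\<close> supplies the derivative as a linear map on the reals; its
      value at 1 is the velocity.\<close>
    have vd: "((\<lambda>\<mu>. q \<mu> 0) has_vector_derivative q' \<mu> 1) (at \<mu> within {0..1})" if "\<mu> \<in> {0..1}" for \<mu>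
    proof -
      have eq: "(\<lambda>h. h *\<^sub>R q' \<mu> 1) = q' \<mu>"
      proof
        show "h *\<^sub>R q' \<mu> 1 = q' \<mu> h" for h
          using linear_cmul[OF has_derivative_linear[OF q'(1)[OF that]], of h 1] by simp
      qed
      show ?thesis unfolding has_vector_derivative_def eq by (rule q'(1)[OF that])
    qed
    have "geo_dist (speed M 0) (q 0 0) (q 1 0) \<le> integral {0..1} (\<lambda>\<mu>. speed M 0 (q \<mu> 0) (q' \<mu> 1))"
      using vd q'(2) by (rule F.geo_dist_le_path_integral)
    also have "\<dots> = weighted_path_len (\<lambda>y. \<Theta> y 0) (\<lambda>\<mu>. q \<mu> 0)"
      unfolding weighted_path_len_def
    proof (rule integral_cong)
      fix \<mu> :: real assume \<mu>: "\<mu> \<in> {0..1}"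
      then have "vector_derivative (\<lambda>\<mu>. q \<mu> 0) (at \<mu> within {0..1}) = q' \<mu> 1"
        by (intro vector_derivative_within_closed_interval vd) auto
      then show "speed M 0 (q \<mu> 0) (q' \<mu> 1)
          = norm (\<Theta> (q \<mu> 0) 0 *v vector_derivative (\<lambda>\<mu>. q \<mu> 0) (at \<mu> within {0..1}))"
        by (simp add: speed_def M_Theta quadratic_form_gram)
    qed
    finally show ?thesis by (simp add: q)
  qed
  then have "geo_dist (speed M 0) (xd 0) (x 0) / sqrt m_lo * exp (- \<alpha>l * T)
      \<le> norm (weighted_path_len (\<lambda>y. \<Theta> y 0) (\<lambda>\<mu>. q \<mu> 0)) / sqrt m_lo * exp (- \<alpha>l * T)"
    using m_lo by (intro mult_right_mono divide_right_mono) auto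
  ultimately show "norm (x T - xd T)
      \<le> norm (weighted_path_len (\<lambda>y. \<Theta> y 0) (\<lambda>\<mu>. q \<mu> 0)) / sqrt m_lo * exp (- \<alpha>l * T)
        + (Lu * \<epsilon>0 + dbar) / \<alpha>l * sqrt (m_hi / m_lo) * (1 - exp (- \<alpha>l * T))"
    by (simp add: real_sqrt_divide)
qed

end
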